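(* (i) There exists an absolute constant $C>0$ such that for every integer $n\ge 2$, any set $V$ of $n$ points in general position in the plane determines at least $n/2^{C\sqrt{\log n}}$ pairwise evading segments. (ii) There exists an absolute constant $c$ such that for every integer $n\ge 2$ and every real $\varepsilon>(\log n)^{-2/3}$, any geometric graph with $n$ vertices and at least $n^{2-\varepsilon}$ edges has at least $n^{1-c\sqrt{\varepsilon}}$ pairwise evading edges.
   Context: A set of points in the plane $\mathbb{R}^2$ is in general position if no three of its points are collinear. A segment is determined by $V$ if both of its (distinct) endpoints belong to $V$. A geometric graph is a finite simple graph $G=(V,E)$ whose vertex set $V$ is a set of points in general position in the plane and whose edges are represented by (possibly crossing) straight-line segments connecting certain pairs of points of $V$. Two segments (edges) are evading if the supporting line of neither of them intersects the closure of the other (so evading segments are in particular disjoint, including endpoints). A family of segments is pairwise evading if any two distinct members are evading; a family consisting of one segment counts as pairwise evading. "At least $T$ pairwise evading segments (edges)" means that there is a family of at least $T$ segments determined by $V$ (edges of the graph) that is pairwise evading. The base of the logarithm is a fixed one (e.g. 2). *)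

theory Defs
  imports "HOL-Analysis.Analysis"
begin

definition general_position :: "(real ^ 2) set \<Rightarrow> bool" where
  "general_position V \<longleftrightarrow> (\<forall>T \<subseteq> V. card T = 3 \<longrightarrow> \<not> collinear T)"

definition determined_segments :: "(real ^ 2) set \<Rightarrow> (real ^ 2) set set" where
  "determined_segments V = {closed_segment a b | a b. a \<in> V \<and> b \<in> V \<and> a \<noteq> b}"

(* Meant for nondegenerate segments S and T: then affine hull S is the supporting line of S. *)
definition evading :: "(real ^ 2) set \<Rightarrow> (real ^ 2) set \<Rightarrow> bool" where
  "evading S T \<longleftrightarrow> affine hull S \<inter> closure T = {} \<and> affine hull T \<inter> closure S = {}"

definition geometric_graph :: "(real ^ 2) set \<Rightarrow> (real ^ 2) set set \<Rightarrow> bool" where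
  "geometric_graph V E \<longleftrightarrow>
     finite V \<and> general_position V \<and> (\<forall>e\<in>E. e \<subseteq> V \<and> card e = 2)"

(* An edge is an unordered pair {a, b} of vertices; the segment representing it
   is convex hull {a, b} = closed_segment a b. *)
definition evading_edges :: "(real ^ 2) set \<Rightarrow> (real ^ 2) set \<Rightarrow> bool" where
  "evading_edges e f \<longleftrightarrow> evading (convex hull e) (convex hull f)"

end

theory Submission
  imports Defs
begin

text \<open>
  Shear the plane so that no two points of \<open>V\<close> lie on a common vertical line, and cut \<open>V\<close> by a
  vertical line into a left part \<open>A\<close> and a right part \<open>B\<close>. Write \<open>M a b\<close> for the slope of the line
  through \<open>a \<in> A\<close> and \<open>b \<in> B\<close>. The segments \<open>ab\<close> and \<open>a'b'\<close> are evading as soon as \<open>a'\<close> lies above \<open>a\<close> as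
  seen from \<open>b\<close> and from \<open>b'\<close>, and \<open>b'\<close> lies above \<open>b\<close> as seen from \<open>a\<close> and from \<open>a'\<close>. These are four
  inequalities between slopes, the relation \<open>prec M\<close>, and the theorem asks for a large set of edges
  from \<open>A\<close> to \<open>B\<close> that are pairwise comparable under \<open>prec M\<close>.

  Call a pair of points of \<open>A\<close> unstable if its line has points of \<open>B\<close> on both sides, that is, if the
  points of \<open>B\<close> disagree about the vertical order of the pair. If few pairs are unstable then, after a
  few points of \<open>A\<close> are discarded, the rest splits into \<open>k\<close> consecutive blocks that every point of \<open>B\<close>
  sees one above the other (\<open>column_blocks\<close>). Split \<open>B\<close> in the same way. Two edges that run between
  the blocks \<open>P i, Q j\<close> and \<open>P i', Q j'\<close> with \<open>i < i'\<close> and \<open>j < j'\<close> are then comparable, so chains found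
  in the block pairs along one diagonal \<open>i - j = const\<close> can be united. The point that makes a
  recursion efficient is \<open>unstable_disjoint\<close>: the blocks \<open>Q j\<close> are separated in the angular order around
  \<open>a\<close>, and a line through \<open>a\<close> cuts the right half-plane at a single angle, so it splits at most one of
  them. Hence all \<open>k\<^sup>2\<close> block pairs together have at most as many unstable pairs as \<open>A, B\<close>, while there are
  fewer than \<open>2 k\<close> diagonals; averaging over the diagonals loses only a factor of 2 per level. Every
  estimate is linear in the number of edges and of unstable pairs, so that averages can be passed
  through all \<open>d\<close> levels of the recursion, and the density of the graph is paid for only once
  (\<open>long_chain\<close>).

  To begin with few unstable pairs, \<open>A\<close> and \<open>B\<close> are divided into \<open>4 ^ J\<close> parts such that a line splits
  at most \<open>3 ^ J\<close> of them (\<open>line_avoiding_partition\<close>, by repeated ham-sandwich cuts); for an average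
  pair of parts the fraction of unstable pairs is then at most \<open>(3/4) ^ J\<close>. With \<open>k = 2 ^ s\<close>,
  \<open>s \<approx> sqrt (log n)\<close>, at most \<open>s\<close> levels, and \<open>J\<close> linear in \<open>s\<close> and in the logarithm of the inverse
  density, the total loss is \<open>2 ^ O(s)\<close> times a power of the inverse density
  (\<open>long_chain_length\<close>, \<open>many_evading_edges\<close>). A graph with \<open>n powr (2 - \<epsilon>)\<close> edges therefore has
  \<open>n powr (1 - O(\<epsilon>)) / 2 powr O(sqrt (log n))\<close> pairwise evading edges. The complete graph gives the first
  claim. For the second one, \<open>\<epsilon> > (log n) powr (- 2 / 3)\<close> makes \<open>sqrt (log n)\<close> at most
  \<open>sqrt \<epsilon> * log n\<close>, and \<open>\<epsilon> \<le> sqrt \<epsilon>\<close> as long as \<open>\<epsilon> \<le> 1\<close>; for larger \<open>\<epsilon>\<close> a single edge suffices.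
\<close>

section \<open>Cutting an almost linear order into blocks\<close>

text \<open>
  The function \<open>h\<close> is a linear extension of \<open>lt\<close>. If \<open>a\<close> and
  \<open>b\<close> are incomparable, then transitivity makes every element between them incomparable to
  \<open>a\<close> or to \<open>b\<close>. Two elements with at most \<open>g\<close> incomparabilities each
  can thus be incomparable only if their ranks differ by at most \<open>2 * g + 1\<close>. So it suffices to
  cut the ranks into intervals of length \<open>l\<close> and to discard the elements with more than
  \<open>g\<close> incomparabilities and the last \<open>2 * g + 1\<close> ranks of every interval.
\<close>
lemma almost_chain_blocks:
  fixes lt :: "'a \<Rightarrow> 'a \<Rightarrow> bool" and h :: "'a \<Rightarrow> real" and k l g :: nat
  assumes fin: "finite A" and inj: "inj_on h A"
    and trans: "\<And>a b c. lt a b \<Longrightarrow> lt b c \<Longrightarrow> lt a c"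
    and ext: "\<And>a b. a \<in> A \<Longrightarrow> b \<in> A \<Longrightarrow> lt a b \<Longrightarrow> h a < h b"
    and card_A: "card A \<le> k * l" and g: "g \<ge> 1"
  obtains P :: "nat \<Rightarrow> 'a set"
  where "\<And>i. P i \<subseteq> A" "\<And>i. card (P i) \<le> l"
    "\<And>i j a a'. i < j \<Longrightarrow> a \<in> P i \<Longrightarrow> a' \<in> P j \<Longrightarrow> lt a a'"
    "g * card (A - (\<Union>i<k. P i)) \<le> card {(a, a'). a \<in> A \<and> a' \<in> A \<and> a \<noteq> a' \<and> \<not> lt a a' \<and> \<not> lt a' a} + 3 * k * g\<^sup>2"
proof -
  define inc where "inc = {(a, a'). a \<in> A \<and> a' \<in> A \<and> a \<noteq> a' \<and> \<not> lt a a' \<and> \<not> lt a' a}"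
  define \<rho> where "\<rho> a = card {x \<in> A. h x < h a}" for a
  define I where "I a = {x \<in> A. x \<noteq> a \<and> \<not> lt a x \<and> \<not> lt x a}" for a
  define P where "P i = {a \<in> A. card (I a) \<le> g \<and> i * l \<le> \<rho> a \<and> \<rho> a + 2 * g + 1 < (i + 1) * l}" for i
  have finI: "finite (I a)" for a using fin by (simp add: I_def)
  have rho_mono: "\<rho> a \<le> \<rho> b" if "h a \<le> h b" for a b
    unfolding \<rho>_def using that fin by (intro card_mono) auto
  have rho_strict: "\<rho> a < \<rho> b" if "h a < h b" "a \<in> A" for a b
    unfolding \<rho>_def using that fin by (intro psubset_card_mono) auto
  have rho_inj: "inj_on \<rho> A"
    using rho_strict inj by (metis inj_onD inj_onI linorder_neqE nat_neq_iff)
  have rho_less: "\<rho> a < card A" if "a \<in> A" for a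
    unfolding \<rho>_def using that fin by (intro psubset_card_mono) auto
  have rho_gap: "\<rho> b \<le> \<rho> a + 1 + card (I a) + card (I b)"
    if "a \<in> A" "b \<in> A" "h a < h b" "\<not> lt a b" for a b
  proof -
    have "{x \<in> A. h x < h b} \<subseteq> {x \<in> A. h x < h a} \<union> {a} \<union> (I a \<union> I b)"
    proof
      fix x assume x: "x \<in> {x \<in> A. h x < h b}"
      show "x \<in> {x \<in> A. h x < h a} \<union> {a} \<union> (I a \<union> I b)"
      proof (cases "h x < h a \<or> x = a")
        case True then show ?thesis using x by auto
      next
        case False
        with x that inj have "h a < h x" by (metis (no_types, lifting) inj_onD linorder_neqE mem_Collect_eq)
        then have "\<not> lt x a" "\<not> lt b x" using ext x that by force+
        then show ?thesis using trans[of a x b] that x False by (auto simp: I_def)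
      qed
    qed
    then have "\<rho> b \<le> card ({x \<in> A. h x < h a} \<union> {a} \<union> (I a \<union> I b))"
      unfolding \<rho>_def using fin finI by (intro card_mono) auto
    also have "\<dots> \<le> \<rho> a + 1 + (card (I a) + card (I b))"
      unfolding \<rho>_def by (intro order_trans[OF card_Un_le] add_mono card_Un_le) (auto simp: card_insert_if)
    finally show ?thesis by simp
  qed
  have order: "lt a b" if "i < j" "a \<in> P i" "b \<in> P j" for i j a b
  proof (rule ccontr)
    assume "\<not> lt a b"
    have "(i + 1) * l \<le> j * l" using \<open>i < j\<close> by (intro mult_right_mono) auto
    then have gap: "\<rho> a + 2 * g + 1 < \<rho> b" using that(2,3) by (simp add: P_def)
    then have "h a < h b" using rho_mono[of b a] by linarith
    then show False using rho_gap[of a b] gap \<open>\<not> lt a b\<close> that(2,3) by (simp add: P_def)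
  qed
  have card_P: "card (P i) \<le> l" for i
  proof -
    have "card (P i) \<le> card {i * l..<(i + 1) * l}"
      using inj_on_subset[OF rho_inj, of "P i"] by (intro card_inj_on_le[of \<rho>]) (auto simp: P_def)
    then show ?thesis by simp
  qed
  define bad where "bad = {a \<in> A. card (I a) > g}"
  define rim where "rim i = {a \<in> A. \<rho> a < (i + 1) * l \<and> (i + 1) * l \<le> \<rho> a + 2 * g + 1}" for i
  have card_rim: "card (rim i) \<le> 3 * g" for i
  proof -
    have "card (rim i) \<le> card {(i + 1) * l - (2 * g + 1)..<(i + 1) * l}"
      using inj_on_subset[OF rho_inj, of "rim i"] by (intro card_inj_on_le[of \<rho>]) (auto simp: rim_def)
    then show ?thesis using g by simp
  qed
  have "A - (\<Union>i<k. P i) \<subseteq> bad \<union> (\<Union>i<k. rim i)"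
  proof
    fix a assume a: "a \<in> A - (\<Union>i<k. P i)"
    have lt: "\<rho> a < k * l" using rho_less[of a] a card_A by auto
    then have l: "l > 0" by (cases l) auto
    define i where "i = \<rho> a div l"
    have "i < k" using lt by (simp add: i_def less_mult_imp_div_less)
    moreover have "i * l \<le> \<rho> a" by (simp add: i_def)
    moreover have "\<rho> a < (i + 1) * l"
      unfolding i_def using l by (metis Suc_eq_plus1 dividend_less_div_times mult_Suc add.commute)
    moreover have "a \<notin> P i" "a \<in> A" using a \<open>i < k\<close> by auto
    ultimately have "a \<in> bad \<or> a \<in> rim i"
      unfolding bad_def rim_def P_def by (auto simp: not_le not_less)
    then show "a \<in> bad \<union> (\<Union>i<k. rim i)" using \<open>i < k\<close> by auto
  qed
  then have "card (A - (\<Union>i<k. P i)) \<le> card bad + card (\<Union>i<k. rim i)"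
    using fin by (intro order_trans[OF card_mono card_Un_le]) (auto simp: bad_def rim_def)
  also have "card (\<Union>i<k. rim i) \<le> (\<Sum>i<k. card (rim i))" by (rule card_UN_le) simp
  also have "\<dots> \<le> k * (3 * g)" using sum_bounded_above[of "{..<k}" "\<lambda>i. card (rim i)" "3 * g"] card_rim by simp
  finally have 1: "g * card (A - (\<Union>i<k. P i)) \<le> g * card bad + 3 * k * g\<^sup>2"
    by (metis (no_types, lifting) ab_semigroup_mult_class.mult_ac(1) add.commute add_le_cancel_left
        distrib_left mult.commute mult_le_mono2 power2_eq_square add_mono le_refl)
  have "g * card bad = (\<Sum>a\<in>bad. g)" by simp
  also have "\<dots> \<le> (\<Sum>a\<in>bad. card (I a))" by (intro sum_mono) (auto simp: bad_def)
  also have "\<dots> \<le> (\<Sum>a\<in>A. card (I a))" using fin by (intro sum_mono2) (auto simp: bad_def)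
  also have "\<dots> = card (SIGMA a:A. I a)" using fin finI by simp
  also have "(SIGMA a:A. I a) = inc" by (auto simp: inc_def I_def)
  finally have "g * card (A - (\<Union>i<k. P i)) \<le> card (inc) + 3 * k * g\<^sup>2" using 1 by linarith
  then show ?thesis using that[of P] order card_P by (auto simp: P_def inc_def)
qed

section \<open>Chains of edges in a matrix of slopes\<close>

text \<open>
  For slopes: the ordered pairs of points of \<open>A\<close> whose line has points of \<open>B\<close> strictly on both sides.
\<close>
definition unstable :: "('a \<Rightarrow> 'b \<Rightarrow> real) \<Rightarrow> 'a set \<Rightarrow> 'b set \<Rightarrow> ('a \<times> 'a) set" where
  "unstable M A B =
     {(a, a'). a \<in> A \<and> a' \<in> A \<and> (\<exists>b\<in>B. M a b < M a' b) \<and> (\<exists>b\<in>B. M a' b < M a b)}"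

text \<open>
  For slopes this exchanges the left and the right point set by a reflection at a vertical line. A
  statement about the rows of \<open>M\<close> becomes one about its columns.
\<close>
definition flip :: "('a \<Rightarrow> 'b \<Rightarrow> real) \<Rightarrow> 'b \<Rightarrow> 'a \<Rightarrow> real" where
  "flip M b a = - M a b"

text \<open>
  The one property of slopes that the recursion uses. The line through \<open>a\<close> and \<open>a'\<close> has slope \<open>\<tau>\<close>, and
  whether \<open>b\<close> lies above or below it can be read off by comparing the slope \<open>M a b\<close> with \<open>\<tau>\<close>. Which
  of the two alternatives holds depends on which of \<open>a, a'\<close> is further to the left.
\<close>
definition thresholded :: "('a \<Rightarrow> 'b \<Rightarrow> real) \<Rightarrow> 'a set \<Rightarrow> 'b set \<Rightarrow> bool" where
  "thresholded M A B \<longleftrightarrow>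
     (\<forall>b\<in>B. inj_on (\<lambda>a. M a b) A) \<and>
     (\<forall>a\<in>A. \<forall>a'\<in>A. a \<noteq> a' \<longrightarrow>
        (\<exists>\<tau>. (\<forall>b\<in>B. M a b < M a' b \<longleftrightarrow> \<tau> < M a b) \<or> (\<forall>b\<in>B. M a b < M a' b \<longleftrightarrow> M a b < \<tau>)))"

definition prec :: "('a \<Rightarrow> 'b \<Rightarrow> real) \<Rightarrow> 'a \<times> 'b \<Rightarrow> 'a \<times> 'b \<Rightarrow> bool" where
  "prec M p p' \<longleftrightarrow>
     M (fst p') (snd p) < M (fst p) (snd p) \<and> M (fst p') (snd p') < M (fst p) (snd p') \<and>
     M (fst p) (snd p) < M (fst p) (snd p') \<and> M (fst p') (snd p) < M (fst p') (snd p')"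

definition chain :: "('a \<Rightarrow> 'b \<Rightarrow> real) \<Rightarrow> ('a \<times> 'b) set \<Rightarrow> bool" where
  "chain M F \<longleftrightarrow> pairwise (\<lambda>p p'. prec M p p' \<or> prec M p' p) F"

lemma thresholded_subset:
  assumes "thresholded M A B" "A' \<subseteq> A" "B' \<subseteq> B"
  shows "thresholded M A' B'"
proof -
  have "\<exists>\<tau>. (\<forall>b\<in>B'. M a b < M a' b \<longleftrightarrow> \<tau> < M a b) \<or> (\<forall>b\<in>B'. M a b < M a' b \<longleftrightarrow> M a b < \<tau>)"
    if "a \<in> A'" "a' \<in> A'" "a \<noteq> a'" for a a'
  proof -
    obtain \<tau> where "(\<forall>b\<in>B. M a b < M a' b \<longleftrightarrow> \<tau> < M a b) \<or> (\<forall>b\<in>B. M a b < M a' b \<longleftrightarrow> M a b < \<tau>)"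
      using assms(1) subsetD[OF assms(2) \<open>a \<in> A'\<close>] subsetD[OF assms(2) \<open>a' \<in> A'\<close>] \<open>a \<noteq> a'\<close>
      unfolding thresholded_def by blast
    then show ?thesis using assms(3) by blast
  qed
  then show ?thesis using assms unfolding thresholded_def by (meson inj_on_subset subsetD)
qed

text \<open>
  Around \<open>a\<close>, all of \<open>X\<close> comes before all of \<open>Y\<close>, and a pair
  \<open>a, a'\<close> separates the points at a single threshold of the order around \<open>a\<close>. The
  threshold cannot lie both inside \<open>X\<close> and inside \<open>Y\<close>.
\<close>
lemma unstable_disjoint:
  assumes thr: "thresholded M A B" and "X \<subseteq> B" "Y \<subseteq> B" and lt: "\<And>a x y. a \<in> A \<Longrightarrow> x \<in> X \<Longrightarrow> y \<in> Y \<Longrightarrow> M a x < M a y"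
  shows "unstable M A X \<inter> unstable M A Y = {}"
proof (rule ccontr)
  assume "\<not> ?thesis"
  then obtain a a' x x' y y' where *: "a \<in> A" "a' \<in> A" "x \<in> X" "x' \<in> X" "y \<in> Y" "y' \<in> Y"
    "M a x < M a' x" "M a' x' < M a x'" "M a y < M a' y" "M a' y' < M a y'"
    unfolding unstable_def by blast
  then have "a \<noteq> a'" by auto
  with * thr obtain \<tau> where \<tau>: "(\<forall>b\<in>B. M a b < M a' b \<longleftrightarrow> \<tau> < M a b) \<or> (\<forall>b\<in>B. M a b < M a' b \<longleftrightarrow> M a b < \<tau>)"
    unfolding thresholded_def by blast
  have "x \<in> B" "y \<in> B" "x' \<in> B" "y' \<in> B" using * assms(2,3) by auto
  then show False using \<tau> lt[of a x y'] lt[of a x' y] * by (smt (verit))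
qed

text \<open>
  Being above with respect to all \<open>b \<in> B\<close> is a strict partial order on \<open>A\<close>.
  Its incomparable pairs are unstable, and the order seen from any single point of \<open>B\<close> is a
  linear extension of it.
\<close>
lemma column_blocks:
  assumes "finite A" "B \<noteq> {}" and inj: "\<And>b. b \<in> B \<Longrightarrow> inj_on (\<lambda>a. M a b) A"
    and "card A \<le> k * l" "g \<ge> 1"
  obtains P :: "nat \<Rightarrow> 'a set"
  where "\<And>i. P i \<subseteq> A" "\<And>i. card (P i) \<le> l"
    "\<And>i j a a' b. i < j \<Longrightarrow> a \<in> P i \<Longrightarrow> a' \<in> P j \<Longrightarrow> b \<in> B \<Longrightarrow> M a' b < M a b"
    "g * card (A - (\<Union>i<k. P i)) \<le> card (unstable M A B) + 3 * k * g\<^sup>2"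
proof -
  obtain b0 where b0: "b0 \<in> B" using assms(2) by auto
  define lt where "lt a a' \<longleftrightarrow> (\<forall>b\<in>B. M a' b < M a b)" for a a'
  have tr: "lt a c" if "lt a b" "lt b c" for a b c
    using that unfolding lt_def by (meson less_trans)
  have in': "inj_on (\<lambda>a. - M a b0) A" using inj[OF b0] by (simp add: inj_on_def)
  have ex: "- M a b0 < - M b b0" if "a \<in> A" "b \<in> A" "lt a b" for a b using that b0 by (auto simp: lt_def)
  obtain P where P: "\<And>i. P i \<subseteq> A" "\<And>i. card (P i) \<le> l"
    "\<And>i j a a'. i < j \<Longrightarrow> a \<in> P i \<Longrightarrow> a' \<in> P j \<Longrightarrow> lt a a'"
    "g * card (A - (\<Union>i<k. P i)) \<le> card {(a, a'). a \<in> A \<and> a' \<in> A \<and> a \<noteq> a' \<and> \<not> lt a a' \<and> \<not> lt a' a} + 3 * k * g\<^sup>2"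
    by (rule almost_chain_blocks[where lt = lt, OF \<open>finite A\<close> in' _ _ \<open>card A \<le> k * l\<close> \<open>g \<ge> 1\<close>])
      (blast intro: tr ex)+
  have sub: "{(a, a'). a \<in> A \<and> a' \<in> A \<and> a \<noteq> a' \<and> \<not> lt a a' \<and> \<not> lt a' a} \<subseteq> unstable M A B"
  proof clarify
    fix a a' assume *: "a \<in> A" "a' \<in> A" "a \<noteq> a'" "\<not> lt a a'" "\<not> lt a' a"
    then have "M a b \<noteq> M a' b" if "b \<in> B" for b using inj[OF that] by (auto dest: inj_onD)
    then show "(a, a') \<in> unstable M A B"
      using * unfolding lt_def unstable_def by (force simp: not_less order.order_iff_strict)
  qed
  have "finite (unstable M A B)"
    by (rule finite_subset[of _ "A \<times> A"]) (use assms(1) in \<open>auto simp: unstable_def\<close>)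
  from card_mono[OF this sub] P(4)
  have "g * card (A - (\<Union>i<k. P i)) \<le> card (unstable M A B) + 3 * k * g\<^sup>2" by linarith
  then show ?thesis using that[of P] P(1-3) by (auto simp: lt_def)
qed

lemma nat_sum_le_card_times_some:
  fixes f :: "'i \<Rightarrow> nat"
  assumes "finite T" "T \<noteq> {}"
  obtains t where "t \<in> T" "sum f T \<le> card T * f t"
proof -
  obtain t where t: "t \<in> T" "f t = Max (f ` T)"
    using assms by (metis (no_types, lifting) Max_in empty_is_image finite_imageI imageE)
  then have "f i \<le> f t" if "i \<in> T" for i using assms that by simp
  then show ?thesis using that t(1) sum_bounded_above[of T f "f t"] by auto
qed

lemma chain_UN:
  assumes "\<And>x. x \<in> D \<Longrightarrow> chain M (F x)"
    and "\<And>x y p p'. x \<in> D \<Longrightarrow> y \<in> D \<Longrightarrow> x \<noteq> y \<Longrightarrow> p \<in> F x \<Longrightarrow> p' \<in> F y \<Longrightarrow> prec M p p' \<or> prec M p' p"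
  shows "chain M (\<Union>x\<in>D. F x)"
  using assms unfolding chain_def pairwise_def by (metis UN_E)

text \<open>
  Subdividing does not create instability: an unstable pair of \<open>A, B\<close> lies in at most one block
  \<open>P i\<close>, and there it is unstable for at most one block \<open>Q j\<close>.
\<close>
lemma card_unstable_blocks_le:
  fixes P :: "nat \<Rightarrow> 'a set" and Q :: "nat \<Rightarrow> 'b set"
  assumes "finite A" "thresholded M A B" and "\<And>i. P i \<subseteq> A" "\<And>j. Q j \<subseteq> B" "B \<noteq> {}"
    and P: "\<And>i j a a' b. i < j \<Longrightarrow> a \<in> P i \<Longrightarrow> a' \<in> P j \<Longrightarrow> b \<in> B \<Longrightarrow> M a' b < M a b"
    and Q: "\<And>i j b b' a. i < j \<Longrightarrow> b \<in> Q i \<Longrightarrow> b' \<in> Q j \<Longrightarrow> a \<in> A \<Longrightarrow> M a b < M a b'"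
  shows "(\<Sum>(i, j)\<in>{..<k} \<times> {..<k}. card (unstable M (P i) (Q j))) \<le> card (unstable M A B)"
proof -
  have fin: "finite (unstable M A B)"
    by (rule finite_subset[of _ "A \<times> A"]) (use assms(1) in \<open>auto simp: unstable_def\<close>)
  have sub: "unstable M (P i) (Q j) \<subseteq> unstable M A B" for i j
    using assms(3)[of i] assms(4)[of j] unfolding unstable_def by blast
  have PP: "P i \<inter> P i' = {}" if "i < i'" for i i'
  proof -
    obtain b where "b \<in> B" using assms(5) by auto
    then show ?thesis using P[OF that _ _ \<open>b \<in> B\<close>] by fastforce
  qed
  have disj: "unstable M (P i) (Q j) \<inter> unstable M (P i') (Q j') = {}" if "(i, j) \<noteq> (i', j')" for i j i' j'
  proof (cases "i = i'")
    case False
    then have "i < i' \<or> i' < i" by auto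
    then have "P i \<inter> P i' = {}" using PP[of i i'] PP[of i' i] by blast
    then show ?thesis by (auto simp: unstable_def)
  next
    case True
    have *: "unstable M (P i) (Q j) \<inter> unstable M (P i) (Q j') = {}" if "j < j'" for j j'
    proof (rule unstable_disjoint[OF thresholded_subset[OF assms(2,3) subset_refl] assms(4,4)])
      show "M a x < M a y" if "a \<in> P i" "x \<in> Q j" "y \<in> Q j'" for a x y
        using Q[OF \<open>j < j'\<close> that(2,3)] assms(3)[of i] that(1) by blast
    qed
    from True that have "j < j' \<or> j' < j" by auto
    then show ?thesis using True *[of j j'] *[of j' j] by blast
  qed
  have "(\<Sum>(i, j)\<in>{..<k} \<times> {..<k}. card (unstable M (P i) (Q j)))
      = card (\<Union>x\<in>{..<k} \<times> {..<k}. unstable M (P (fst x)) (Q (snd x)))"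
    by (subst card_UN_disjoint)
      (use fin sub disj in \<open>auto simp: case_prod_beta intro: finite_subset\<close>)
  also have "\<dots> \<le> card (unstable M A B)" using fin sub by (intro card_mono) auto
  finally show ?thesis .
qed

text \<open>
  The recursion. With \<open>m = q * k ^ d\<close> as a bound for the sizes of both sets, it says that a
  chain has at least \<open>(card E - d * q * k * u - (6 * d / q) * m\<^sup>2) / (2 ^ d * q * m)\<close>
  elements, where \<open>u\<close> counts unstable pairs. The bound is linear in \<open>card E\<close> and
  \<open>u\<close>, hence can be summed over all block pairs. The first error term pays for the points with
  many incomparabilities, the second one for the points at the rims of the blocks. The parameter
  \<open>q\<close> is the size at which the recursion stops and takes a single edge, and its reciprocal is
  the scale of the fraction of points lost at the rims.
\<close>
theorem long_chain:
  fixes M :: "'a \<Rightarrow> 'b \<Rightarrow> real" and q k d :: nat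
  assumes q: "q \<ge> 1" and k: "k \<ge> 1"
    and "finite A" "finite B" "card A \<le> q * k ^ d" "card B \<le> q * k ^ d"
    and "thresholded M A B" "thresholded (flip M) B A" "E \<subseteq> A \<times> B"
  shows "\<exists>F\<subseteq>E. chain M F \<and>
    card E \<le> 2 ^ d * q * (q * k ^ d) * card F
      + d * q * k * (card (unstable M A B) + card (unstable (flip M) B A))
      + 6 * d * q * k ^ (2 * d)"
  using assms(3-)
proof (induction d arbitrary: A B E)
  case 0
  show ?case
  proof (cases "E = {}")
    case True then show ?thesis by (auto simp: chain_def)
  next
    case False
    then obtain e where e: "e \<in> E" by auto
    have "card E \<le> card (A \<times> B)" using 0 by (intro card_mono) auto
    also have "\<dots> \<le> q * q" unfolding card_cartesian_product using 0 by (intro mult_mono) auto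
    finally show ?thesis using e by (intro exI[of _ "{e}"]) (auto simp: chain_def)
  qed
next
  case (Suc d)
  note fin = \<open>finite A\<close> \<open>finite B\<close> and thr = Suc.prems(5,6)
  show ?case
  proof (cases "E = {}")
    case True then show ?thesis by (auto simp: chain_def)
  next
    case False
    then have ne: "A \<noteq> {}" "B \<noteq> {}" using Suc.prems by auto
    define l where "l = q * k ^ d"
    \<comment> \<open>Discarding blocks of \<open>O(g)\<close> ranks at each of the \<open>k\<close> rims costs a fraction \<open>O(g / l)\<close> of all points;
      the choice \<open>g = l / q\<close> makes this \<open>O(1 / q)\<close>.\<close>
    define g where "g = k ^ d"
    have g: "g \<ge> 1" using k by (simp add: g_def)
    have m: "q * k ^ Suc d = k * l" by (simp add: l_def)
    have cd: "card A \<le> k * l" "card B \<le> k * l" using Suc.prems(3,4) unfolding m .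
    have inj: "inj_on (\<lambda>a. M a b) A" if "b \<in> B" for b using thr(1) that by (simp add: thresholded_def)
    have inj': "inj_on (\<lambda>b. flip M b a) B" if "a \<in> A" for a using thr(2) that by (simp add: thresholded_def)
    obtain P where P: "\<And>i. P i \<subseteq> A" "\<And>i. card (P i) \<le> l"
      "\<And>i j a a' b. i < j \<Longrightarrow> a \<in> P i \<Longrightarrow> a' \<in> P j \<Longrightarrow> b \<in> B \<Longrightarrow> M a' b < M a b"
      "g * card (A - (\<Union>i<k. P i)) \<le> card (unstable M A B) + 3 * k * g\<^sup>2"
      by (rule column_blocks[OF fin(1) ne(2) inj cd(1) g]) blast+
    obtain Q where Q: "\<And>i. Q i \<subseteq> B" "\<And>i. card (Q i) \<le> l"
      "\<And>i j b b' a. i < j \<Longrightarrow> b \<in> Q i \<Longrightarrow> b' \<in> Q j \<Longrightarrow> a \<in> A \<Longrightarrow> flip M b' a < flip M b a"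
      "g * card (B - (\<Union>i<k. Q i)) \<le> card (unstable (flip M) B A) + 3 * k * g\<^sup>2"
      by (rule column_blocks[OF fin(2) ne(1) inj' cd(2) g]) blast+
    have Q3: "M a b < M a b'" if "i < j" "b \<in> Q i" "b' \<in> Q j" "a \<in> A" for i j b b' a
      using Q(3)[OF that] by (simp add: flip_def)
    have P3: "flip M b a < flip M b a'" if "i < j" "a \<in> P i" "a' \<in> P j" "b \<in> B" for i j a a' b
      using P(3)[OF that] by (simp add: flip_def)
    define G where "G = {..<k} \<times> {..<k}"
    define Eb where "Eb x = E \<inter> P (fst x) \<times> Q (snd x)" for x
    define U where "U = card (unstable M A B) + card (unstable (flip M) B A)"
    define u where "u x = card (unstable M (P (fst x)) (Q (snd x))) + card (unstable (flip M) (Q (snd x)) (P (fst x)))" for x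
    have "\<exists>F\<subseteq>Eb x. chain M F \<and> card (Eb x) \<le> 2 ^ d * q * l * card F + d * q * k * u x + 6 * d * q * k ^ (2 * d)" for x
      unfolding u_def l_def
    proof (rule Suc.IH)
      show "finite (P (fst x))" "finite (Q (snd x))" 
        using finite_subset[OF P(1) fin(1)] finite_subset[OF Q(1) fin(2)] by simp_all
      show "card (P (fst x)) \<le> q * k ^ d" "card (Q (snd x)) \<le> q * k ^ d" using P(2) Q(2) by (simp_all add: l_def)
      show "thresholded M (P (fst x)) (Q (snd x))" "thresholded (flip M) (Q (snd x)) (P (fst x))"

        using thresholded_subset[OF thr(1) P(1) Q(1)] thresholded_subset[OF thr(2) Q(1) P(1)] by simp_all
    qed (simp add: Eb_def)
    then obtain F where F: "\<And>x. F x \<subseteq> Eb x" "\<And>x. chain M (F x)"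
      "\<And>x. card (Eb x) \<le> 2 ^ d * q * l * card (F x) + d * q * k * u x + 6 * d * q * k ^ (2 * d)" by metis
    \<comment> \<open>The offset \<open>k\<close> keeps the index of a diagonal a natural number. On a diagonal both block indices
      increase together, which is what makes edges from different block pairs comparable.\<close>
    define diag where "diag t = {x \<in> G. fst x + k - snd x = t}" for t
    define f where "f t = (\<Sum>x\<in>diag t. card (F x))" for t
    have finG: "finite G" by (simp add: G_def)
    have "(\<Sum>t<2 * k. f t) = (\<Sum>x\<in>G. card (F x))"
      unfolding f_def diag_def by (rule sum.group) (auto simp: G_def)
    moreover obtain t where "(\<Sum>t<2 * k. f t) \<le> card {..<2 * k} * f t"
      by (rule nat_sum_le_card_times_some[of "{..<2 * k}" f]) (use k in \<open>auto simp: lessThan_empty_iff\<close>)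
    ultimately have t: "(\<Sum>x\<in>G. card (F x)) \<le> 2 * k * f t" by simp
    define H where "H = (\<Union>x\<in>diag t. F x)"
    have H_sub: "H \<subseteq> E" using F(1) unfolding H_def Eb_def by blast
    have finE: "finite E" using finite_subset[OF Suc.prems(7) finite_cartesian_product[OF fin]] .
    have ord: "prec M p p'" if "x \<in> diag t" "y \<in> diag t" "p \<in> F x" "p' \<in> F y" "fst x < fst y" for x y p p'
    proof -
      have "snd x < snd y" using that(1,2,5) by (auto simp: diag_def G_def)
      have "p \<in> Eb x" "p' \<in> Eb y" using F(1) that(3,4) by blast+
      then have p: "fst p \<in> P (fst x)" "snd p \<in> Q (snd x)" "fst p' \<in> P (fst y)" "snd p' \<in> Q (snd y)"
        by (simp_all add: Eb_def mem_Times_iff)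
      then have "fst p \<in> A" "snd p \<in> B" "fst p' \<in> A" "snd p' \<in> B" using P(1) Q(1) by blast+
      then show ?thesis unfolding prec_def
        using p P(3)[OF that(5)] Q3[OF \<open>snd x < snd y\<close>] by simp
    qed
    have cross: "prec M p p' \<or> prec M p' p" if "x \<in> diag t" "y \<in> diag t" "x \<noteq> y" "p \<in> F x" "p' \<in> F y" for x y p p'
    proof -
      have "fst x \<noteq> fst y" using that by (auto simp: diag_def G_def prod_eq_iff)
      then show ?thesis using ord[of x y p p'] ord[of y x p' p] that nat_neq_iff by blast
    qed
    have "chain M H" unfolding H_def using F(2) cross by (intro chain_UN) auto
    have irr: "\<not> prec M p p" for p by (simp add: prec_def)
    have "card H = f t" unfolding H_def f_def
    proof (rule card_UN_disjoint)
      show "finite (diag t)" using finG by (simp add: diag_def)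
      show "\<forall>x\<in>diag t. finite (F x)" 
        using finite_subset[OF F(1)] finE by (simp add: Eb_def)
      show "\<forall>x\<in>diag t. \<forall>y\<in>diag t. x \<noteq> y \<longrightarrow> F x \<inter> F y = {}" using cross irr by blast
    qed
    \<comment> \<open>An edge outside all block pairs has a discarded endpoint, and each discarded point carries at most
      \<open>k * l\<close> edges.\<close>
    let ?A' = "A - (\<Union>i<k. P i)" and ?B' = "B - (\<Union>i<k. Q i)"
    have "E \<subseteq> (\<Union>x\<in>G. Eb x) \<union> (?A' \<times> B \<union> A \<times> ?B')"
      using Suc.prems(7) by (fastforce simp: Eb_def G_def)
    then have "card E \<le> card ((\<Union>x\<in>G. Eb x) \<union> (?A' \<times> B \<union> A \<times> ?B'))"
      using fin finE finG by (intro card_mono) (auto simp: Eb_def)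
    also have "\<dots> \<le> card (\<Union>x\<in>G. Eb x) + (card (?A' \<times> B) + card (A \<times> ?B'))"
      by (intro order_trans[OF card_Un_le] add_mono card_Un_le order_refl)
    also have "\<dots> \<le> (\<Sum>x\<in>G. card (Eb x)) + (card ?A' * (k * l) + k * l * card ?B')"
      unfolding card_cartesian_product
      by (intro add_mono card_UN_le finG mult_mono cd order_refl) simp_all
    finally have e1: "card E \<le> (\<Sum>x\<in>G. card (Eb x)) + (card ?A' * (k * l) + k * l * card ?B')" .
    have "card ?A' * (k * l) + k * l * card ?B' = q * k * (g * card ?A' + g * card ?B')"
      by (simp add: l_def g_def algebra_simps)
    also have "\<dots> \<le> q * k * (U + 6 * k * g\<^sup>2)"
      by (intro mult_left_mono, unfold U_def) (use P(4) Q(4) in linarith, simp)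
    also have "\<dots> = q * k * U + 6 * q * k ^ (2 * Suc d)"
      by (simp add: g_def algebra_simps power2_eq_square flip: power_add) (simp add: mult_2_right)
    finally have e2: "card ?A' * (k * l) + k * l * card ?B' \<le> q * k * U + 6 * q * k ^ (2 * Suc d)" .
    have U: "(\<Sum>x\<in>G. u x) \<le> U"
    proof -
      have 1: "(\<Sum>(i, j)\<in>{..<k} \<times> {..<k}. card (unstable M (P i) (Q j))) \<le> card (unstable M A B)"
        by (rule card_unstable_blocks_le[OF fin(1) thr(1) P(1) Q(1) ne(2) P(3) Q3])
      have 2: "(\<Sum>(i, j)\<in>{..<k} \<times> {..<k}. card (unstable (flip M) (Q i) (P j))) \<le> card (unstable (flip M) B A)"
        by (rule card_unstable_blocks_le[OF fin(2) thr(2) Q(1) P(1) ne(1) Q(3) P3])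
      have "(\<Sum>(i, j)\<in>{..<k} \<times> {..<k}. card (unstable (flip M) (Q i) (P j)))
          = (\<Sum>(j, i)\<in>{..<k} \<times> {..<k}. card (unstable (flip M) (Q i) (P j)))"
        unfolding sum.cartesian_product[symmetric] by (rule sum.swap)
      then show ?thesis using 1 2
        unfolding G_def u_def U_def sum.distrib by (simp add: case_prod_beta)
    qed
    have "(\<Sum>x\<in>G. card (Eb x)) \<le> (\<Sum>x\<in>G. 2 ^ d * q * l * card (F x) + d * q * k * u x + 6 * d * q * k ^ (2 * d))"
      by (intro sum_mono F(3))
    also have "\<dots> = 2 ^ d * q * l * (\<Sum>x\<in>G. card (F x)) + d * q * k * (\<Sum>x\<in>G. u x) + k * k * (6 * d * q * k ^ (2 * d))"
      by (simp add: sum.distrib sum_distrib_left G_def)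
    also have "\<dots> \<le> 2 ^ d * q * l * (2 * k * card H) + d * q * k * U + k * k * (6 * d * q * k ^ (2 * d))"
      using t U \<open>card H = f t\<close> by (intro add_mono mult_left_mono) simp_all
    finally have e3: "(\<Sum>x\<in>G. card (Eb x)) \<le> \<dots>" .
    have arith: "e \<le> x + (c + a) + (y + b)" if "e \<le> s + t" "t \<le> a + b" "s \<le> x + c + y" for e s t a b x c y :: nat
      using that by linarith
    have e4: "2 ^ d * q * l * (2 * k * card H) = 2 ^ Suc d * q * (q * k ^ Suc d) * card H"
      by (simp add: l_def)
    have e5: "k * k * (6 * d * q * k ^ (2 * d)) = 6 * d * q * k ^ (2 * Suc d)" by simp
    have "card E \<le> 2 ^ Suc d * q * (q * k ^ Suc d) * card H + (d * q * k * U + q * k * U)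
        + (6 * d * q * k ^ (2 * Suc d) + 6 * q * k ^ (2 * Suc d))"
      by (rule arith[OF e1 e2 e3[unfolded e4 e5]])
    moreover have "d * q * k * U + q * k * U = Suc d * q * k * U"
      "6 * d * q * k ^ (2 * Suc d) + 6 * q * k ^ (2 * Suc d) = 6 * Suc d * q * k ^ (2 * Suc d)"
      by (simp_all add: algebra_simps)
    ultimately have "card E \<le> 2 ^ Suc d * q * (q * k ^ Suc d) * card H + Suc d * q * k * U + 6 * Suc d * q * k ^ (2 * Suc d)"
      by (simp only:)
    with H_sub \<open>chain M H\<close> show ?thesis unfolding U_def by (intro exI[of _ H] conjI)
  qed
qed

section \<open>Partitions whose parts are rarely split by a line\<close>

text \<open>
  Dually, \<open>L\<close> is a family of increasing and \<open>R\<close> a family of decreasing lines over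
  \<open>s\<close>, and the lemma finds a point \<open>(s, t)\<close> on the level \<open>a\<close> of the
  first and the level \<open>b\<close> (from above) of the second family. The level of the increasing lines
  increases, that of the decreasing lines decreases, so they meet. The finite form of this argument
  maximises, over all \<open>S \<subseteq> L\<close> of size \<open>a\<close> and
  \<open>T \<subseteq> R\<close> of size \<open>b\<close>, the largest \<open>s\<close> at which
  \<open>S\<close> is still weakly below \<open>T\<close>. If one of the strict counts at the optimum were
  too large, then \<open>S\<close> or \<open>T\<close> could be replaced by a set with strict inequalities,
  and \<open>s\<close> could be increased.
\<close>
lemma finite_ham_sandwich:
  fixes y d :: "'p \<Rightarrow> real"
  assumes "finite L" "finite R" and a: "1 \<le> a" "a \<le> card L" and b: "1 \<le> b" "b \<le> card R"
    and d: "\<And>p. p \<in> L \<union> R \<Longrightarrow> d p > 0"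
  obtains s t where
    "card {p \<in> L. y p + s * d p < t} < a" "a \<le> card {p \<in> L. y p + s * d p \<le> t}"
    "card {p \<in> R. y p - s * d p > t} < b" "b \<le> card {p \<in> R. y p - s * d p \<ge> t}"
proof -
  \<comment> \<open>the abscissa at which the lines of \<open>p\<close> and \<open>q\<close> cross\<close>
  define \<sigma> where "\<sigma> p q = (y q - y p) / (d p + d q)" for p q
  have le_iff: "y p + s * d p \<le> y q - s * d q \<longleftrightarrow> s \<le> \<sigma> p q"
    and less_iff: "y p + s * d p < y q - s * d q \<longleftrightarrow> s < \<sigma> p q" if "p \<in> L" "q \<in> R" for p q s
    using d[of p] d[of q] that by (simp_all add: \<sigma>_def field_simps)
  define fam where "fam = {(S, T). S \<subseteq> L \<and> card S = a \<and> T \<subseteq> R \<and> card T = b}"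
  define val where "val ST = Min ((\<lambda>(p, q). \<sigma> p q) ` (fst ST \<times> snd ST))" for ST
  have "fam \<subseteq> Pow L \<times> Pow R" by (auto simp: fam_def)
  then have fin_fam: "finite fam" using assms(1,2) by (meson finite_Pow_iff finite_SigmaI finite_subset)
  obtain S0 T0 where "S0 \<subseteq> L" "card S0 = a" "T0 \<subseteq> R" "card T0 = b"
    using obtain_subset_with_card_n[OF a(2)] obtain_subset_with_card_n[OF b(2)] by metis
  then have "fam \<noteq> {}" by (auto simp: fam_def)
  then have "Max (val ` fam) \<in> val ` fam" using fin_fam by (intro Max_in) auto
  then obtain S T where ST: "(S, T) \<in> fam" and max: "val (S, T) = Max (val ` fam)" by auto
  define s where "s = val (S, T)"
  have val_le: "val ST \<le> s" if "ST \<in> fam" for ST using that fin_fam by (simp add: s_def max)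
  have in_fam: "finite S'" "finite T'" "S' \<noteq> {}" "T' \<noteq> {}" "S' \<subseteq> L" "T' \<subseteq> R" if "(S', T') \<in> fam" for S' T'
    using that a(1) b(1) assms(1,2) finite_subset by (auto simp: fam_def)
  have no_better: False if "(S', T') \<in> fam" "\<And>p q. p \<in> S' \<Longrightarrow> q \<in> T' \<Longrightarrow> y p + s * d p < y q - s * d q" for S' T'
  proof -
    note * = in_fam[OF that(1)]
    have "val (S', T') \<in> (\<lambda>(p, q). \<sigma> p q) ` (S' \<times> T')"
      unfolding val_def using * by (simp only: fst_conv snd_conv, intro Min_in) auto
    then obtain p q where "p \<in> S'" "q \<in> T'" "val (S', T') = \<sigma> p q" by auto
    then show False using that(2)[of p q] less_iff[of p q s] val_le[OF that(1)] * by auto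
  qed
  note inST = in_fam[OF ST]
  have "s \<in> (\<lambda>(p, q). \<sigma> p q) ` (S \<times> T)"
    unfolding s_def val_def using inST by (simp only: fst_conv snd_conv, intro Min_in) auto
  then obtain p0 q0 where pq0: "p0 \<in> S" "q0 \<in> T" "s = \<sigma> p0 q0" by auto
  have s_le: "s \<le> \<sigma> p q" if "p \<in> S" "q \<in> T" for p q
    unfolding s_def val_def using inST that by (intro Min_le) auto
  define t where "t = y p0 + s * d p0"
  have t': "t = y q0 - s * d q0"
  proof -
    have "p0 \<in> L" "q0 \<in> R" using pq0 inST by blast+
    then show ?thesis using le_iff[of p0 q0 s] less_iff[of p0 q0 s] pq0(3) by (simp add: t_def)
  qed
  have S_le: "y p + s * d p \<le> t" if "p \<in> S" for p
    using le_iff[OF subsetD[OF inST(5) that] subsetD[OF inST(6) pq0(2)]] s_le[OF that pq0(2)] by (simp add: t')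
  have T_ge: "y q - s * d q \<ge> t" if "q \<in> T" for q
    using le_iff[OF subsetD[OF inST(5) pq0(1)] subsetD[OF inST(6) that]] s_le[OF pq0(1) that] by (simp add: t_def)
  have cards: "card S = a" "card T = b" using ST by (auto simp: fam_def)
  have 1: "a \<le> card {p \<in> L. y p + s * d p \<le> t}"
    unfolding cards(1)[symmetric] using S_le inST assms(1) by (intro card_mono) auto
  have 2: "b \<le> card {p \<in> R. y p - s * d p \<ge> t}"
    unfolding cards(2)[symmetric] using T_ge inST assms(2) by (intro card_mono) auto
  have 3: "card {p \<in> L. y p + s * d p < t} < a"
  proof (rule ccontr)
    assume "\<not> ?thesis"
    then obtain S' where S': "S' \<subseteq> {p \<in> L. y p + s * d p < t}" "card S' = a"
      by (meson not_less obtain_subset_with_card_n)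
    show False
    proof (rule no_better[of S' T])
      show "(S', T) \<in> fam" using S' ST by (auto simp: fam_def)
      show "y p + s * d p < y q - s * d q" if "p \<in> S'" "q \<in> T" for p q
        using S'(1) that T_ge[of q] by force
    qed
  qed
  have 4: "card {p \<in> R. y p - s * d p > t} < b"
  proof (rule ccontr)
    assume "\<not> ?thesis"
    then obtain T' where T': "T' \<subseteq> {p \<in> R. y p - s * d p > t}" "card T' = b"
      by (meson not_less obtain_subset_with_card_n)
    show False
    proof (rule no_better[of S T'])
      show "(S, T') \<in> fam" using T' ST by (auto simp: fam_def)
      show "y p + s * d p < y q - s * d q" if "p \<in> S" "q \<in> T'" for p q
        using T'(1) that S_le[of p] by force
    qed
  qed
  show ?thesis using that 1 2 3 4 by blast
qed

lemma threshold_with_card_below: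
  fixes S :: "real set"
  assumes "finite S" "j \<le> card S"
  shows "\<exists>c. c \<notin> S \<and> card {x \<in> S. x < c} = j"
  using assms(2)
proof (induction j)
  case 0
  obtain c where "\<forall>x\<in>S. c < x"
    using assms(1) by (metis finite_has_minimal2 bdd_below_finite bdd_below_def lt_ex order_less_le_trans)
  then have "c \<notin> S \<and> {x \<in> S. x < c} = {}" by force
  then show ?case by (metis card.empty)
next
  case (Suc j)
  then obtain c where c: "c \<notin> S" "card {x \<in> S. x < c} = j" by auto
  let ?U = "{x \<in> S. x > c}"
  have "?U \<noteq> {}"
  proof
    assume "?U = {}"
    then have "{x \<in> S. x < c} = S" using c(1) by (force simp: not_less order.order_iff_strict)
    then show False using Suc.prems c(2) by simp
  qed
  then have m: "Min ?U \<in> ?U" using assms(1) by (intro Min_in) auto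
  define m where "m = Min ?U"
  obtain c' where c': "m < c'" "\<And>x. x \<in> S \<Longrightarrow> m < x \<Longrightarrow> c' < x"
  proof (cases "{x \<in> S. m < x} = {}")
    case True then show ?thesis using that[of "m + 1"] by force
  next
    case False
    have "Min {x \<in> S. m < x} \<in> {x \<in> S. m < x}" using False assms(1) by (intro Min_in) auto
    then obtain z where "m < z" "z < Min {x \<in> S. m < x}" using dense by blast
    moreover have "z < x" if "x \<in> S" "m < x" for x
      by (rule less_le_trans[OF \<open>z < Min {x \<in> S. m < x}\<close> Min_le]) (use that assms(1) in auto)
    ultimately show ?thesis using that[of z] by blast
  qed
  have "{x \<in> S. x < c'} = insert m {x \<in> S. x < c}"
  proof (intro set_eqI iffI)
    fix x assume x: "x \<in> {x \<in> S. x < c'}"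
    then have "x \<le> m" using c'(2)[of x] by force
    show "x \<in> insert m {x \<in> S. x < c}"
    proof (cases "x < c")
      case False
      then have "x \<in> ?U" using x c(1) by (auto simp: not_less order.order_iff_strict)
      then have "m \<le> x" unfolding m_def using assms(1) by (intro Min_le) auto
      then show ?thesis using \<open>x \<le> m\<close> by simp
    qed (use x in auto)
  next
    fix x assume "x \<in> insert m {x \<in> S. x < c}"
    then show "x \<in> {x \<in> S. x < c'}" using m c'(1) by (auto simp: m_def)
  qed
  moreover have "m \<notin> {x \<in> S. x < c}" using m by (auto simp: m_def)
  ultimately have "card {x \<in> S. x < c'} = Suc j" using c(2) assms(1) by simp
  moreover have "c' \<notin> S" using c' by blast
  ultimately show ?case by blast
qed

definition splits :: "('p \<Rightarrow> real) \<Rightarrow> 'p set \<Rightarrow> bool" where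
  "splits h S \<longleftrightarrow> (\<exists>p\<in>S. h p < 0) \<and> (\<exists>p\<in>S. h p > 0)"

text \<open>
  A vertical line halves \<open>P\<close>, and a ham-sandwich line halves both halves at the same time. Any
  third line misses the interior of one of the four quadrants formed by these two lines. In the coordinates
  \<open>G = X - c\<close> and \<open>H\<close> given by the two lines it has an equation
  \<open>c0 + b0 * G + \<gamma> * H = 0\<close>, and it misses the quadrant on which \<open>b0 * G\<close>
  and \<open>\<gamma> * H\<close> both have the sign of \<open>c0\<close>. Points on the two lines may be
  put on either side, because \<open>splits\<close> asks for points strictly on both sides.
\<close>
lemma quarter_partition:
  fixes X Y :: "'p \<Rightarrow> real"
  assumes fin: "finite P" and inj: "inj_on X P" and card: "card P \<le> 4 * w"
  obtains c :: "'p \<Rightarrow> nat" where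
    "\<And>p. c p < 4" "\<And>i. card {p \<in> P. c p = i} \<le> w"
    "\<And>\<alpha> \<beta> \<gamma>. \<exists>i<4. \<not> splits (\<lambda>p. \<alpha> + \<beta> * X p + \<gamma> * Y p) {p \<in> P. c p = i}"
proof (cases "card P \<le> 1")
  case True
  then have "card {p \<in> P. 0 = i} \<le> w" for i :: nat using card by (cases "card P"; cases "i = 0") auto
  moreover have "\<not> splits h {p \<in> P. 0 = (1::nat)}" for h by (simp add: splits_def)
  ultimately show ?thesis using that[of "\<lambda>_. 0"] by (metis one_less_numeral_iff semiring_norm(76) zero_less_numeral)
next
  case False
  define j where "j = card P div 2"
  have cX: "card (X ` P) = card P" using inj by (rule card_image)
  obtain c where c: "c \<notin> X ` P" "card {x \<in> X ` P. x < c} = j"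
    using threshold_with_card_below[of "X ` P" j] fin cX by (auto simp: j_def)
  define L where "L = {p \<in> P. X p < c}"
  define R where "R = {p \<in> P. X p > c}"
  have "X ` L = {x \<in> X ` P. x < c}" by (auto simp: L_def)
  then have cL: "card L = j" using c(2) inj card_image[of X L] by (metis (no_types, lifting) L_def inj_on_subset mem_Collect_eq subsetI)
  have P: "P = L \<union> R" using c(1) by (auto simp: L_def R_def not_less order.order_iff_strict)
  have disj: "L \<inter> R = {}" by (auto simp: L_def R_def)
  have finLR: "finite L" "finite R" using fin by (auto simp: L_def R_def)
  have cR: "card L + card R = card P" using P disj finLR by (simp add: card_Un_disjoint)
  define a where "a = (card L + 1) div 2"
  define b where "b = (card R + 1) div 2"
  have ab: "1 \<le> a" "a \<le> card L" "1 \<le> b" "b \<le> card R" "a \<le> w" "b \<le> w" "card L - a \<le> w" "card R - b \<le> w"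
    using cL cR False card by (auto simp: a_def b_def j_def)
  have d: "\<bar>X p - c\<bar> > 0" if "p \<in> L \<union> R" for p using that by (auto simp: L_def R_def)
  obtain s t where st:
    "card {p \<in> L. Y p + s * \<bar>X p - c\<bar> < t} < a" "a \<le> card {p \<in> L. Y p + s * \<bar>X p - c\<bar> \<le> t}"
    "card {p \<in> R. Y p - s * \<bar>X p - c\<bar> > t} < b" "b \<le> card {p \<in> R. Y p - s * \<bar>X p - c\<bar> \<ge> t}"
    by (rule finite_ham_sandwich[OF finLR ab(1-4), of "\<lambda>p. \<bar>X p - c\<bar>" Y]) (use d in auto)
  \<comment> \<open>\<open>H\<close> vanishes on the ham-sandwich line; since \<open>X p - c\<close> is negative on \<open>L\<close> and positive on \<open>R\<close>,
    it agrees with both of the expressions that are counted above, up to the shift by \<open>t\<close>.\<close>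
  define H where "H p = Y p - s * (X p - c) - t" for p
  have H1: "{p \<in> L. Y p + s * \<bar>X p - c\<bar> < t} = {p \<in> L. H p < 0}" "{p \<in> L. Y p + s * \<bar>X p - c\<bar> \<le> t} = {p \<in> L. H p \<le> 0}"
    by (auto simp: L_def H_def algebra_simps)
  have H2: "{p \<in> R. Y p - s * \<bar>X p - c\<bar> > t} = {p \<in> R. H p > 0}" "{p \<in> R. Y p - s * \<bar>X p - c\<bar> \<ge> t} = {p \<in> R. H p \<ge> 0}"
    by (auto simp: R_def H_def algebra_simps)
  obtain D where D: "{p \<in> L. H p < 0} \<subseteq> D" "D \<subseteq> {p \<in> L. H p \<le> 0}" "card D = a"
  proof -
    have "\<exists>D. {p \<in> L. H p < 0} \<subseteq> D \<and> D \<subseteq> {p \<in> L. H p \<le> 0} \<and> card D = a"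
      using st(1,2) finLR unfolding H1 by (intro exists_subset_between) auto
    then show ?thesis using that by blast
  qed
  obtain T where T: "{p \<in> R. H p > 0} \<subseteq> T" "T \<subseteq> {p \<in> R. H p \<ge> 0}" "card T = b"
  proof -
    have "\<exists>T. {p \<in> R. H p > 0} \<subseteq> T \<and> T \<subseteq> {p \<in> R. H p \<ge> 0} \<and> card T = b"
      using st(3,4) finLR unfolding H2 by (intro exists_subset_between) auto
    then show ?thesis using that by blast
  qed
  define col where "col p = (if p \<in> D then 0 else if p \<in> L then 1 else if p \<in> T then 2 else 3::nat)" for p
  have DL: "D \<subseteq> L" and TR: "T \<subseteq> R" using D T by auto
  have cls: "{p \<in> P. col p = 0} = D" "{p \<in> P. col p = 1} = L - D" "{p \<in> P. col p = 2} = T" "{p \<in> P. col p = 3} = R - T"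
    using DL TR P disj by (auto simp: col_def split: if_splits)
  have col4: "col p < 4" for p by (simp add: col_def)
  have "card {p \<in> P. col p = i} \<le> w" for i
  proof (cases "i < 4")
    case True
    then have "i \<in> {0, 1, 2, 3}" by auto
    then show ?thesis using cls D(3) T(3) ab card_Diff_subset[of D L] card_Diff_subset[of T R] DL TR finLR
      by (auto simp: finite_subset)
  next
    case False
    then have "{p \<in> P. col p = i} = {}" using col4 by force
    then show ?thesis by (simp only: card.empty le0)
  qed
  moreover have "\<exists>i<4. \<not> splits (\<lambda>p. \<alpha> + \<beta> * X p + \<gamma> * Y p) {p \<in> P. col p = i}" for \<alpha> \<beta> \<gamma>
  proof -
    define c0 b0 where "c0 = \<alpha> + \<beta> * c + \<gamma> * t" and "b0 = \<beta> + \<gamma> * s"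
    have eq: "\<alpha> + \<beta> * X p + \<gamma> * Y p = c0 + b0 * (X p - c) + \<gamma> * H p" for p
      by (simp add: c0_def b0_def H_def algebra_simps)
    have sg: "p \<in> D \<Longrightarrow> X p - c \<le> 0 \<and> H p \<le> 0" "p \<in> L - D \<Longrightarrow> X p - c \<le> 0 \<and> H p \<ge> 0"
      "p \<in> T \<Longrightarrow> X p - c \<ge> 0 \<and> H p \<ge> 0" "p \<in> R - T \<Longrightarrow> X p - c \<ge> 0 \<and> H p \<le> 0" for p
      using D(1,2) T(1,2) by (auto simp: L_def R_def not_less intro: leI)
    have nn: "0 \<le> b * G" if "b \<ge> 0 \<and> G \<ge> 0 \<or> b \<le> 0 \<and> G \<le> 0" for b G :: real
      using that by (auto intro: mult_nonneg_nonneg mult_nonpos_nonpos)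
    have np: "b * G \<le> 0" if "b \<ge> 0 \<and> G \<le> 0 \<or> b \<le> 0 \<and> G \<ge> 0" for b G :: real
      using that by (auto intro: mult_nonneg_nonpos mult_nonpos_nonneg)
    define pos where "pos i \<longleftrightarrow> (\<forall>p\<in>{p \<in> P. col p = i}. 0 \<le> b0 * (X p - c) \<and> 0 \<le> \<gamma> * H p)" for i
    define neg where "neg i \<longleftrightarrow> (\<forall>p\<in>{p \<in> P. col p = i}. b0 * (X p - c) \<le> 0 \<and> \<gamma> * H p \<le> 0)" for i
    have pn: "\<exists>i<4. pos i" "\<exists>i<4. neg i"
    proof -
      consider "b0 \<ge> 0" "\<gamma> \<ge> 0" | "b0 \<ge> 0" "\<gamma> \<le> 0" | "b0 \<le> 0" "\<gamma> \<ge> 0" | "b0 \<le> 0" "\<gamma> \<le> 0" by linarith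
      then have "(pos 2 \<and> neg 0) \<or> (pos 3 \<and> neg 1) \<or> (pos 1 \<and> neg 3) \<or> (pos 0 \<and> neg 2)"
      proof cases
        case 1 then have "pos 2 \<and> neg 0" unfolding pos_def neg_def cls using sg by (blast intro: nn np)
        then show ?thesis by blast
      next
        case 2 then have "pos 3 \<and> neg 1" unfolding pos_def neg_def cls using sg by (blast intro: nn np)
        then show ?thesis by blast
      next
        case 3 then have "pos 1 \<and> neg 3" unfolding pos_def neg_def cls using sg by (blast intro: nn np)
        then show ?thesis by blast
      next
        case 4 then have "pos 0 \<and> neg 2" unfolding pos_def neg_def cls using sg by (blast intro: nn np)
        then show ?thesis by blast
      qed
      moreover have "0 < (4::nat)" "1 < (4::nat)" "2 < (4::nat)" "3 < (4::nat)" by simp_all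
      ultimately show "\<exists>i<4. pos i" "\<exists>i<4. neg i" by blast+
    qed
    show ?thesis
    proof (cases "c0 \<ge> 0")
      case True
      obtain i where "i < 4" "pos i" using pn by blast
      moreover have "\<not> splits (\<lambda>p. \<alpha> + \<beta> * X p + \<gamma> * Y p) {p \<in> P. col p = i}"
        unfolding splits_def eq using \<open>pos i\<close>[unfolded pos_def] True
        by (metis (no_types, lifting) add_nonneg_nonneg not_less)
      ultimately show ?thesis by blast
    next
      case False
      obtain i where "i < 4" "neg i" using pn by blast
      moreover have "\<not> splits (\<lambda>p. \<alpha> + \<beta> * X p + \<gamma> * Y p) {p \<in> P. col p = i}"
        unfolding splits_def eq using \<open>neg i\<close>[unfolded neg_def] False
        by (metis (no_types, lifting) add_nonpos_nonpos linear not_less)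
      ultimately show ?thesis by blast
    qed
  qed
  ultimately show ?thesis using that[of col] col4 by blast
qed

theorem line_avoiding_partition:
  fixes X Y :: "'p \<Rightarrow> real"
  assumes fin: "finite P" and inj: "inj_on X P" and card: "card P \<le> 4 ^ J * w"
  shows "\<exists>c :: 'p \<Rightarrow> nat. (\<forall>p. c p < 4 ^ J) \<and> (\<forall>i. card {p \<in> P. c p = i} \<le> w) \<and>
    (\<forall>\<alpha> \<beta> \<gamma>. card {i. i < 4 ^ J \<and> splits (\<lambda>p. \<alpha> + \<beta> * X p + \<gamma> * Y p) {p \<in> P. c p = i}} \<le> 3 ^ J)"
  using assms
proof (induction J arbitrary: P)
  case 0
  have "card {p \<in> P. 0 = i} \<le> w" for i :: nat using 0 by (cases "i = 0") auto
  moreover have "card {i::nat. i < 1 \<and> Q i} \<le> 1" for Q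
    by (rule order_trans[OF card_mono[of "{0}"]]) auto
  ultimately show ?case by (intro exI[of _ "\<lambda>_. 0"]) auto
next
  case (Suc J)
  obtain c where c: "\<And>p. c p < (4::nat)" "\<And>i. card {p \<in> P. c p = i} \<le> 4 ^ J * w"
    "\<And>\<alpha> \<beta> \<gamma>. \<exists>i<4. \<not> splits (\<lambda>p. \<alpha> + \<beta> * X p + \<gamma> * Y p) {p \<in> P. c p = i}"
    using quarter_partition[OF Suc.prems(1,2), of "4 ^ J * w" Y] Suc.prems(3) by auto
  define Pc where "Pc i = {p \<in> P. c p = i}" for i
  define good where "good i c' \<longleftrightarrow> (\<forall>p. c' p < 4 ^ J) \<and> (\<forall>j. card {p \<in> Pc i. c' p = j} \<le> w) \<and>
    (\<forall>\<alpha> \<beta> \<gamma>. card {j. j < 4 ^ J \<and> splits (\<lambda>p. \<alpha> + \<beta> * X p + \<gamma> * Y p) {p \<in> Pc i. c' p = j}} \<le> 3 ^ J)"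
    for i and c' :: "'p \<Rightarrow> nat"
  have "\<exists>c'. good i c'" for i
    unfolding good_def
  proof (rule Suc.IH)
    show "finite (Pc i)" "inj_on X (Pc i)" using Suc.prems(1,2) by (auto simp: Pc_def inj_on_def)
    show "card (Pc i) \<le> 4 ^ J * w" using c(2) by (simp add: Pc_def)
  qed
  then obtain c' where "\<And>i. good i (c' i)" by metis
  then have c': "\<And>i p. c' i p < 4 ^ J" "\<And>i j. card {p \<in> Pc i. c' i p = j} \<le> w"
    "\<And>i \<alpha> \<beta> \<gamma>. card {j. j < 4 ^ J \<and> splits (\<lambda>p. \<alpha> + \<beta> * X p + \<gamma> * Y p) {p \<in> Pc i. c' i p = j}} \<le> 3 ^ J"
    unfolding good_def by blast+
  define e where "e p = 4 * c' (c p) p + c p" for p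
  have cls: "{p \<in> P. e p = n} = {p \<in> Pc (n mod 4). c' (n mod 4) p = n div 4}" for n
  proof -
    have "e p = n \<longleftrightarrow> c p = n mod 4 \<and> c' (c p) p = n div 4" for p
      using c(1)[of p] unfolding e_def by auto
    then have "e p = n \<longleftrightarrow> c p = n mod 4 \<and> c' (n mod 4) p = n div 4" for p by metis
    then show ?thesis by (simp only: Pc_def mem_Collect_eq conj_assoc)
  qed
  have "e p < 4 ^ Suc J" for p using c(1)[of p] c'(1)[of "c p" p] by (simp add: e_def)
  moreover have "card {p \<in> P. e p = n} \<le> w" for n unfolding cls by (rule c'(2))
  moreover have "card {n. n < 4 ^ Suc J \<and> splits (\<lambda>p. \<alpha> + \<beta> * X p + \<gamma> * Y p) {p \<in> P. e p = n}} \<le> 3 ^ Suc J" for \<alpha> \<beta> \<gamma>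
  proof -
    let ?h = "\<lambda>p. \<alpha> + \<beta> * X p + \<gamma> * Y p"
    obtain i0 where i0: "i0 < 4" "\<not> splits ?h (Pc i0)" using c(3)[of \<alpha> \<beta> \<gamma>] unfolding Pc_def by blast
    define K where "K i = {j. j < 4 ^ J \<and> splits ?h {p \<in> Pc i. c' i p = j}}" for i
    have finK: "finite (K i)" for i unfolding K_def by simp
    have "{n. n < 4 ^ Suc J \<and> splits ?h {p \<in> P. e p = n}} \<subseteq> (\<lambda>(i, j). 4 * j + i) ` (SIGMA i:{..<4} - {i0}. K i)"
    proof clarify
      fix n :: nat assume n: "n < 4 ^ Suc J" "splits ?h {p \<in> P. e p = n}"
      then have "splits ?h {p \<in> Pc (n mod 4). c' (n mod 4) p = n div 4}" unfolding cls by simp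
      moreover from this have "n mod 4 \<noteq> i0" using i0(2) unfolding splits_def by blast
      ultimately have "(n mod 4, n div 4) \<in> (SIGMA i:{..<4} - {i0}. K i)" using n(1) by (auto simp: K_def)
      then show "n \<in> (\<lambda>(i, j). 4 * j + i) ` (SIGMA i:{..<4} - {i0}. K i)"
        by (rule rev_image_eqI) simp
    qed
    then have "card {n. n < 4 ^ Suc J \<and> splits ?h {p \<in> P. e p = n}} \<le> card (SIGMA i:{..<4} - {i0}. K i)"
      using finK by (intro surj_card_le) auto
    also have "\<dots> = (\<Sum>i\<in>{..<4} - {i0}. card (K i))" using finK by simp
    also have "\<dots> \<le> card ({..<4} - {i0}) * 3 ^ J"
      using sum_bounded_above[of "{..<4} - {i0}" "\<lambda>i. card (K i)" "3 ^ J"] c'(3) by (simp add: K_def)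
    also have "\<dots> = 3 ^ Suc J" using i0(1) by simp
    finally show ?thesis .
  qed
  ultimately show ?case by blast
qed

section \<open>Slopes between two separated point sets\<close>

definition slope :: "('p \<Rightarrow> real) \<Rightarrow> ('p \<Rightarrow> real) \<Rightarrow> 'p \<Rightarrow> 'p \<Rightarrow> real" where
  "slope X Y a b = (Y b - Y a) / (X b - X a)"

text \<open>
  For three points with increasing abscissae, the slope between the outer two is a weighted mean of the
  slopes of the two consecutive segments. So it lies between them, and comparing any two of the three slopes
  decides the order of all three.
\<close>
lemma slope_thresholded:
  assumes lt: "\<And>a b. a \<in> A \<Longrightarrow> b \<in> B \<Longrightarrow> X a < X b"
    and inj: "inj_on X A" "\<And>b. b \<in> B \<Longrightarrow> inj_on (\<lambda>a. slope X Y a b) A"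
  shows "thresholded (slope X Y) A B"
proof -
  have "\<exists>\<tau>. (\<forall>b\<in>B. slope X Y a b < slope X Y a' b \<longleftrightarrow> \<tau> < slope X Y a b) \<or>
            (\<forall>b\<in>B. slope X Y a b < slope X Y a' b \<longleftrightarrow> slope X Y a b < \<tau>)"
    if "a \<in> A" "a' \<in> A" "a \<noteq> a'" for a a'
  proof (intro exI[of _ "slope X Y a a'"])
    have sl: "(p + r) / (u + v) < r / v \<longleftrightarrow> p / u < (p + r) / (u + v)"
      "r / v < (p + r) / (u + v) \<longleftrightarrow> r / v < p / u" if "u > 0" "v > 0" for p r u v :: real
    proof -
      have "u + v > 0" using that by simp
      then have "(p + r) / (u + v) < r / v \<longleftrightarrow> p * v < r * u" "p / u < (p + r) / (u + v) \<longleftrightarrow> p * v < r * u"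
        "r / v < (p + r) / (u + v) \<longleftrightarrow> r * u < p * v" "r / v < p / u \<longleftrightarrow> r * u < p * v"
        using that by (simp_all add: divide_less_eq less_divide_eq field_simps)
      then show "(p + r) / (u + v) < r / v \<longleftrightarrow> p / u < (p + r) / (u + v)"
        "r / v < (p + r) / (u + v) \<longleftrightarrow> r / v < p / u" by simp_all
    qed
    have "X a \<noteq> X a'" using inj(1) that by (auto dest: inj_onD)
    then consider "X a < X a'" | "X a' < X a" by linarith
    then show "(\<forall>b\<in>B. slope X Y a b < slope X Y a' b \<longleftrightarrow> slope X Y a a' < slope X Y a b) \<or>
            (\<forall>b\<in>B. slope X Y a b < slope X Y a' b \<longleftrightarrow> slope X Y a b < slope X Y a a')"
    proof cases
      case 1
      have "slope X Y a b < slope X Y a' b \<longleftrightarrow> slope X Y a a' < slope X Y a b" if "b \<in> B" for b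
        using sl(1)[of "X a' - X a" "X b - X a'" "Y a' - Y a" "Y b - Y a'"] 1 lt[OF \<open>a' \<in> A\<close> that]
        by (simp add: slope_def)
      then show ?thesis by blast
    next
      case 2
      have "slope X Y a b < slope X Y a' b \<longleftrightarrow> slope X Y a b < slope X Y a a'" if "b \<in> B" for b
      proof -
        have "slope X Y a a' = (Y a - Y a') / (X a - X a')"
          unfolding slope_def by (metis minus_diff_eq minus_divide_divide)
        then show ?thesis
          using sl(2)[of "X a - X a'" "X b - X a" "Y b - Y a" "Y a - Y a'"] 2 lt[OF \<open>a \<in> A\<close> that]
          by (simp add: slope_def)
      qed
      then show ?thesis by blast
    qed
  qed
  note threshold = this
  show ?thesis unfolding thresholded_def by (intro conjI ballI impI inj(2) threshold)
qed

lemma flip_slope: "flip (slope X Y) = slope (\<lambda>p. - X p) Y"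
proof (intro ext)
  fix b a
  have "- ((Y b - Y a) / (X b - X a)) = (Y a - Y b) / (X b - X a)"
    by (metis minus_diff_eq minus_divide_left)
  then show "flip (slope X Y) b a = slope (\<lambda>p. - X p) Y b a" by (simp add: flip_def slope_def)
qed

text \<open>
  The affine function is the orientation determinant of \<open>a, a', p\<close>: it vanishes on the line
  through \<open>a\<close> and \<open>a'\<close>. Its sign tells on which side of that line \<open>p\<close>
  lies, which is the comparison of the two slopes at \<open>p\<close>.
\<close>
lemma unstable_slope_splits:
  assumes lt: "\<And>a b. a \<in> A \<Longrightarrow> b \<in> B \<Longrightarrow> X a < X b" and "(a, a') \<in> unstable (slope X Y) A B"
  shows "splits (\<lambda>p. (Y a * X a' - Y a' * X a) + (Y a' - Y a) * X p + (X a - X a') * Y p) B"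
proof -
  have A: "a \<in> A" "a' \<in> A" using assms(2) by (auto simp: unstable_def)
  have eq: "slope X Y a b < slope X Y a' b \<longleftrightarrow>
      (Y a * X a' - Y a' * X a) + (Y a' - Y a) * X b + (X a - X a') * Y b < 0"
    "slope X Y a' b < slope X Y a b \<longleftrightarrow>
      (Y a * X a' - Y a' * X a) + (Y a' - Y a) * X b + (X a - X a') * Y b > 0" if "b \<in> B" for b
  proof -
    have "X b - X a > 0" "X b - X a' > 0" using lt[OF A(1) that] lt[OF A(2) that] by auto
    then have "slope X Y a b < slope X Y a' b \<longleftrightarrow> (Y b - Y a) * (X b - X a') < (Y b - Y a') * (X b - X a)"
      "slope X Y a' b < slope X Y a b \<longleftrightarrow> (Y b - Y a') * (X b - X a) < (Y b - Y a) * (X b - X a')"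
      unfolding slope_def by (simp_all add: divide_less_eq less_divide_eq mult.commute)
    then show "slope X Y a b < slope X Y a' b \<longleftrightarrow>
      (Y a * X a' - Y a' * X a) + (Y a' - Y a) * X b + (X a - X a') * Y b < 0"
      "slope X Y a' b < slope X Y a b \<longleftrightarrow>
      (Y a * X a' - Y a' * X a) + (Y a' - Y a) * X b + (X a - X a') * Y b > 0"
      by (auto simp: algebra_simps)
  qed
  obtain b b' where "b \<in> B" "b' \<in> B" "slope X Y a b < slope X Y a' b" "slope X Y a' b' < slope X Y a b'"
    using assms(2) unfolding unstable_def by blast
  then show ?thesis using eq[of b] eq[of b'] unfolding splits_def by blast
qed

lemma sum_indicator_eq_card:
  "finite S \<Longrightarrow> (\<Sum>x\<in>S. if P x then 1 else 0) = card {x \<in> S. P x}"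
  by (simp flip: sum.inter_filter)

text \<open>
  Double counting: each of the at most \<open>w\<^sup>2\<close> pairs of \<open>A\<close> spans a line, and
  this line splits at most \<open>D\<close> classes of \<open>B\<close>.
\<close>
lemma sum_card_unstable_le:
  fixes c :: "'p \<Rightarrow> nat"
  assumes lt: "\<And>a b. a \<in> A \<Longrightarrow> b \<in> B \<Longrightarrow> X a < X b" and "finite A" "card A \<le> w"
    and c: "\<And>\<alpha> \<beta> \<gamma>. card {j. j < r \<and> splits (\<lambda>p. \<alpha> + \<beta> * X p + \<gamma> * Y p) {p \<in> B. c p = j}} \<le> D"
  shows "(\<Sum>j<r. card (unstable (slope X Y) A {b \<in> B. c b = j})) \<le> D * w\<^sup>2"
proof -
  let ?u = "\<lambda>j. unstable (slope X Y) A {b \<in> B. c b = j}"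
  have sub: "?u j \<subseteq> A \<times> A" for j by (auto simp: unstable_def)
  have "(\<Sum>j<r. card (?u j)) = (\<Sum>j<r. \<Sum>x\<in>A \<times> A. if x \<in> ?u j then 1 else 0)"
  proof (intro sum.cong refl)
    fix j
    have "(\<Sum>x\<in>A \<times> A. if x \<in> ?u j then 1 else 0) = card {x \<in> A \<times> A. x \<in> ?u j}"
      using assms(2) by (intro sum_indicator_eq_card) simp
    also have "{x \<in> A \<times> A. x \<in> ?u j} = ?u j" using sub by blast
    finally show "card (?u j) = (\<Sum>x\<in>A \<times> A. if x \<in> ?u j then 1 else 0)" by simp
  qed
  also have "\<dots> = (\<Sum>x\<in>A \<times> A. \<Sum>j<r. if x \<in> ?u j then 1 else 0)" by (rule sum.swap)
  also have "\<dots> \<le> (\<Sum>x\<in>A \<times> A. D)"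
  proof (intro sum_mono)
    fix x assume "x \<in> A \<times> A"
    obtain a a' where x: "x = (a, a')" by (cases x)
    have "(\<Sum>j<r. if x \<in> ?u j then 1 else 0) = card {j \<in> {..<r}. x \<in> ?u j}"
      by (rule sum_indicator_eq_card) simp
    also have "\<dots> \<le> card {j. j < r \<and> splits (\<lambda>p. (Y a * X a' - Y a' * X a) + (Y a' - Y a) * X p + (X a - X a') * Y p) {p \<in> B. c p = j}}"
    proof (rule card_mono)
      show "{j \<in> {..<r}. x \<in> ?u j} \<subseteq> {j. j < r \<and> splits (\<lambda>p. (Y a * X a' - Y a' * X a) + (Y a' - Y a) * X p + (X a - X a') * Y p) {p \<in> B. c p = j}}"
      proof
        fix j assume j: "j \<in> {j \<in> {..<r}. x \<in> ?u j}"
        then have u: "(a, a') \<in> ?u j" by (simp add: x)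
        have "splits (\<lambda>p. (Y a * X a' - Y a' * X a) + (Y a' - Y a) * X p + (X a - X a') * Y p) {p \<in> B. c p = j}"
          by (rule unstable_slope_splits[OF lt u]) auto
        then show "j \<in> {j. j < r \<and> splits (\<lambda>p. (Y a * X a' - Y a' * X a) + (Y a' - Y a) * X p + (X a - X a') * Y p) {p \<in> B. c p = j}}"
          using j by simp
      qed
    qed simp
    also have "\<dots> \<le> D" by (rule c)
    finally show "(\<Sum>j<r. if x \<in> ?u j then 1 else 0) \<le> D" .
  qed
  also have "\<dots> = card A * card A * D" by (simp add: card_cartesian_product)
  also have "\<dots> \<le> w * w * D" using assms(3) by (intro mult_mono) auto
  finally show ?thesis by (simp add: power2_eq_square mult.commute)
qed

text \<open>
  Apply \<open>long_chain\<close> to all \<open>16 ^ J\<close> pairs of parts and keep the longest chain.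
  Since the bound is linear, only the total number of unstable pairs matters, which is at most
  \<open>2 * 4 ^ J * 3 ^ J * w\<^sup>2\<close>, a fraction \<open>(3/4) ^ J\<close> of all pairs.
\<close>
theorem long_chain_of_separated:
  fixes X Y :: "'p \<Rightarrow> real" and q k d J :: nat
  defines "w \<equiv> q * k ^ d"
  assumes q: "q \<ge> 1" and k: "k \<ge> 1" and fin: "finite A" "finite B"
    and cd: "card A \<le> 4 ^ J * w" "card B \<le> 4 ^ J * w"
    and lt: "\<And>a b. a \<in> A \<Longrightarrow> b \<in> B \<Longrightarrow> X a < X b"
    and inj: "inj_on X A" "inj_on X B"
      "\<And>b. b \<in> B \<Longrightarrow> inj_on (\<lambda>a. slope X Y a b) A" "\<And>a. a \<in> A \<Longrightarrow> inj_on (\<lambda>b. slope X Y a b) B"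
    and E: "E \<subseteq> A \<times> B"
  shows "\<exists>F\<subseteq>E. chain (slope X Y) F \<and>
    card E \<le> 2 ^ d * q * w * (16 ^ J * card F) + d * q * k * (2 * 12 ^ J * w\<^sup>2)
      + 16 ^ J * (6 * d * q * k ^ (2 * d))"
proof -
  define N :: "'p \<Rightarrow> real" where "N p = - X p" for p
  have flip: "flip (slope X Y) = slope N Y" unfolding N_def by (rule flip_slope)
  have injN: "inj_on N A" "inj_on N B" using inj(1,2) by (auto simp: N_def inj_on_def)
  have thr: "thresholded (slope X Y) A B" using lt inj by (intro slope_thresholded) auto
  have slN: "slope N Y b a = - slope X Y a b" for a b using flip by (metis flip_def)
  have thrN: "thresholded (slope N Y) B A"
  proof (rule slope_thresholded)
    show "inj_on (\<lambda>b. slope N Y b a) B" if "a \<in> A" for a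
      unfolding slN using inj(4)[OF that] by (auto simp: inj_on_def)
  qed (use lt injN in \<open>auto simp: N_def\<close>)
  obtain cA :: "'p \<Rightarrow> nat" where cA: "\<And>p. cA p < 4 ^ J" "\<And>i. card {p \<in> A. cA p = i} \<le> w"
    "\<And>\<alpha> \<beta> \<gamma>. card {i. i < 4 ^ J \<and> splits (\<lambda>p. \<alpha> + \<beta> * N p + \<gamma> * Y p) {p \<in> A. cA p = i}} \<le> 3 ^ J"
    using line_avoiding_partition[OF fin(1) injN(1) cd(1), of Y] by blast
  obtain cB :: "'p \<Rightarrow> nat" where cB: "\<And>p. cB p < 4 ^ J" "\<And>i. card {p \<in> B. cB p = i} \<le> w"
    "\<And>\<alpha> \<beta> \<gamma>. card {i. i < 4 ^ J \<and> splits (\<lambda>p. \<alpha> + \<beta> * X p + \<gamma> * Y p) {p \<in> B. cB p = i}} \<le> 3 ^ J"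
    using line_avoiding_partition[OF fin(2) inj(2) cd(2), of Y] by blast
  define PA where "PA i = {p \<in> A. cA p = i}" for i
  define PB where "PB i = {p \<in> B. cB p = i}" for i
  define r :: nat where "r = 4 ^ J"
  define G where "G = {..<r} \<times> {..<r}"
  define Eb where "Eb x = E \<inter> PA (fst x) \<times> PB (snd x)" for x
  define u where "u x = card (unstable (slope X Y) (PA (fst x)) (PB (snd x))) + card (unstable (slope N Y) (PB (snd x)) (PA (fst x)))" for x
  have sub: "PA i \<subseteq> A" "PB i \<subseteq> B" for i by (auto simp: PA_def PB_def)
  have finP: "finite (PA i)" "finite (PB i)" for i 
    using finite_subset[OF sub(1) fin(1)] finite_subset[OF sub(2) fin(2)] by simp_all
  have cP: "card (PA i) \<le> w" "card (PB i) \<le> w" for i using cA(2) cB(2) by (simp_all add: PA_def PB_def)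
  have "\<exists>F\<subseteq>Eb x. chain (slope X Y) F \<and> card (Eb x) \<le> 2 ^ d * q * w * card F + d * q * k * u x + 6 * d * q * k ^ (2 * d)" for x
    unfolding u_def w_def flip[symmetric]
  proof (rule long_chain[OF q k finP(1) finP(2) cP(1)[unfolded w_def] cP(2)[unfolded w_def]])
    show "thresholded (slope X Y) (PA (fst x)) (PB (snd x))" using thresholded_subset[OF thr sub] .
    show "thresholded (flip (slope X Y)) (PB (snd x)) (PA (fst x))"
      unfolding flip using thresholded_subset[OF thrN sub(2) sub(1)] .
  qed (simp add: Eb_def)
  then obtain F where F: "\<And>x. F x \<subseteq> Eb x" "\<And>x. chain (slope X Y) (F x)"
    "\<And>x. card (Eb x) \<le> 2 ^ d * q * w * card (F x) + d * q * k * u x + 6 * d * q * k ^ (2 * d)" by metis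
  have finG: "finite G" and cG: "card G = 16 ^ J"
    by (simp_all add: G_def r_def card_cartesian_product flip: power_mult_distrib)
  have "r > 0" by (simp add: r_def)
  then have "(0, 0) \<in> G" by (simp add: G_def)
  then have "G \<noteq> {}" by blast
  obtain z where z: "(\<Sum>x\<in>G. card (F x)) \<le> 16 ^ J * card (F z)"
    using nat_sum_le_card_times_some[OF finG \<open>G \<noteq> {}\<close>, of "\<lambda>x. card (F x)"] cG by metis
  have Ucol: "(\<Sum>x\<in>G. u x) \<le> 2 * 12 ^ J * w\<^sup>2"
  proof -
    have 1: "(\<Sum>j<r. card (unstable (slope X Y) (PA i) (PB j))) \<le> 3 ^ J * w\<^sup>2" for i
      unfolding PB_def r_def using lt sub(1)[of i] by (intro sum_card_unstable_le finP cP cB(3)) auto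
    have 2: "(\<Sum>i<r. card (unstable (slope N Y) (PB j) (PA i))) \<le> 3 ^ J * w\<^sup>2" for j
      unfolding PA_def r_def using lt sub(2)[of j] by (intro sum_card_unstable_le finP cP cA(3)) (auto simp: N_def)
    have "(\<Sum>x\<in>G. u x) = (\<Sum>i<r. \<Sum>j<r. card (unstable (slope X Y) (PA i) (PB j)))
        + (\<Sum>i<r. \<Sum>j<r. card (unstable (slope N Y) (PB j) (PA i)))"
      unfolding G_def u_def sum.distrib by (simp add: sum.cartesian_product case_prod_beta)
    also have "(\<Sum>i<r. \<Sum>j<r. card (unstable (slope N Y) (PB j) (PA i)))
        = (\<Sum>j<r. \<Sum>i<r. card (unstable (slope N Y) (PB j) (PA i)))" by (rule sum.swap)
    also have "(\<Sum>i<r. \<Sum>j<r. card (unstable (slope X Y) (PA i) (PB j)))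
        + (\<Sum>j<r. \<Sum>i<r. card (unstable (slope N Y) (PB j) (PA i)))
        \<le> (\<Sum>i<r. 3 ^ J * w\<^sup>2) + (\<Sum>j<r. 3 ^ J * w\<^sup>2)"
      by (intro add_mono sum_mono 1 2)
    also have "\<dots> = 2 * (4 ^ J * 3 ^ J) * w\<^sup>2" by (simp add: r_def)
    also have "4 ^ J * 3 ^ J = (12 ^ J :: nat)" by (simp flip: power_mult_distrib)
    finally show ?thesis .
  qed
  have "E \<subseteq> (\<Union>x\<in>G. Eb x)"
  proof
    fix e assume e: "e \<in> E"
    then have "e \<in> Eb (cA (fst e), cB (snd e))" using E by (auto simp: Eb_def PA_def PB_def)
    moreover have "(cA (fst e), cB (snd e)) \<in> G" using cA(1) cB(1) by (simp add: G_def r_def)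
    ultimately show "e \<in> (\<Union>x\<in>G. Eb x)" by blast
  qed
  moreover have finE: "finite E" using finite_subset[OF E finite_cartesian_product[OF fin]] .
  ultimately have "card E \<le> card (\<Union>x\<in>G. Eb x)" using finG by (intro card_mono) (auto simp: Eb_def)
  also have "\<dots> \<le> (\<Sum>x\<in>G. card (Eb x))" by (rule card_UN_le[OF finG])
  also have "\<dots> \<le> (\<Sum>x\<in>G. 2 ^ d * q * w * card (F x) + d * q * k * u x + 6 * d * q * k ^ (2 * d))"
    by (intro sum_mono F(3))
  also have "\<dots> = 2 ^ d * q * w * (\<Sum>x\<in>G. card (F x)) + d * q * k * (\<Sum>x\<in>G. u x) + 16 ^ J * (6 * d * q * k ^ (2 * d))"
    by (simp add: sum.distrib sum_distrib_left cG)
  also have "\<dots> \<le> 2 ^ d * q * w * (16 ^ J * card (F z)) + d * q * k * (2 * 12 ^ J * w\<^sup>2) + 16 ^ J * (6 * d * q * k ^ (2 * d))"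
    using z Ucol by (intro add_mono mult_left_mono) simp_all
  finally have "card E \<le> \<dots>" .
  moreover have "F z \<subseteq> E" using F(1)[of z] by (auto simp: Eb_def)
  ultimately show ?thesis using F(2)[of z] by (intro exI[of _ "F z"] conjI)
qed

section \<open>Choice of the parameters\<close>

text \<open>
  The choice of parameters for a bipartite graph of density \<open>2 ^ - v\<close>. Each of \<open>q\<close>
  and \<open>J\<close> is chosen such that one error term of \<open>long_chain_of_separated\<close> is at
  most a quarter of \<open>card E\<close>: the size of \<open>q\<close> controls the rims of the blocks, and
  \<open>J\<close> controls the unstable pairs, where \<open>(4/3) ^ 3 \<ge> 2\<close> explains
  \<open>J = 3 * h\<close>. The number of levels is the least one for which the sets fit, so that the total
  size \<open>W\<close> available to the parts exceeds \<open>n\<close> by at most the factor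
  \<open>k\<close>.
\<close>
lemma long_chain_length:
  fixes X Y :: "'p \<Rightarrow> real" and n s v :: nat
  assumes s: "s \<ge> 1" and n: "n \<ge> 1" "n \<le> 2 ^ (s * s)" and fin: "finite A" "finite B"
    and cd: "card A \<le> n" "card B \<le> n"
    and lt: "\<And>a b. a \<in> A \<Longrightarrow> b \<in> B \<Longrightarrow> X a < X b"
    and inj: "inj_on X A" "inj_on X B"
      "\<And>b. b \<in> B \<Longrightarrow> inj_on (\<lambda>a. slope X Y a b) A" "\<And>a. a \<in> A \<Longrightarrow> inj_on (\<lambda>b. slope X Y a b) B"
    and E: "E \<subseteq> A \<times> B" and dense: "n\<^sup>2 \<le> 2 ^ v * card E"
  shows "\<exists>F\<subseteq>E. chain (slope X Y) F \<and> n \<le> 2 ^ (54 + 47 * s + 14 * v) * card F"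
proof -
  define h where "h = 8 + 7 * s + 2 * v"
  define J where "J = 3 * h"
  define k :: nat where "k = 2 ^ s"
  define q :: nat where "q = 2 ^ (5 + 3 * s + v)"
  have four: "(4::nat) ^ J = 2 ^ (6 * h)" by (simp add: J_def power_mult)
  show ?thesis
  proof (cases "n \<le> 4 ^ J * q")
    \<comment> \<open>Here the bound is so weak that one edge is enough.\<close>
    case True
    have "card E \<noteq> 0" using dense n by (cases "card E = 0") auto
    then have "E \<noteq> {}" by auto
    then obtain e where e: "e \<in> E" by blast
    have "n \<le> 2 ^ (6 * h + (5 + 3 * s + v))" using True by (simp add: four q_def power_add)
    also have "\<dots> \<le> 2 ^ (54 + 47 * s + 14 * v)" by (intro power_increasing) (auto simp: h_def)
    finally show ?thesis using e by (intro exI[of _ "{e}"]) (auto simp: chain_def)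
  next
    case False
    have "s < k" unfolding k_def by (rule less_exp)
    have "\<exists>d. n \<le> 4 ^ J * (q * k ^ d)"
    proof
      have "n \<le> k ^ s" using n(2) by (simp add: k_def power_mult)
      also have "\<dots> \<le> 4 ^ J * (q * k ^ s)" by (simp add: q_def)
      finally show "n \<le> 4 ^ J * (q * k ^ s)" .
    qed
    then obtain d where d: "n \<le> 4 ^ J * (q * k ^ d)" "\<And>i. i < d \<Longrightarrow> \<not> n \<le> 4 ^ J * (q * k ^ i)"
      using exists_least_iff[of "\<lambda>d. n \<le> 4 ^ J * (q * k ^ d)"] by blast
    then obtain d' where d': "d = Suc d'" using False by (cases d) auto
    define w where "w = q * k ^ d"
    define W where "W = 4 ^ J * w"
    have below: "4 ^ J * (q * k ^ d') < n" using d(2)[of d'] d' by simp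
    have Wk: "W \<le> k * n" using below by (simp add: W_def w_def d' mult.left_commute)
    have "k ^ d' \<le> 4 ^ J * (q * k ^ d')" by (simp add: q_def)
    also have "\<dots> < n" by (rule below)
    also have "\<dots> \<le> k ^ s" using n(2) by (simp add: k_def power_mult)
    finally have "k ^ d' < k ^ s" .
    moreover have "1 < k" using \<open>s < k\<close> s by linarith
    ultimately have "d' < s" by (rule power_less_imp_less_exp[rotated])
    then have ds: "d \<le> s" "d \<le> k" using d' \<open>s < k\<close> by auto
    have k1: "k \<ge> 1" and q1: "q \<ge> 1" by (simp_all add: k_def q_def)
    have cd': "card A \<le> 4 ^ J * (q * k ^ d)" "card B \<le> 4 ^ J * (q * k ^ d)" using cd d(1) by auto
    obtain F where F: "F \<subseteq> E" "chain (slope X Y) F"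
      "card E \<le> 2 ^ d * q * w * (16 ^ J * card F) + d * q * k * (2 * 12 ^ J * w\<^sup>2)
      + 16 ^ J * (6 * d * q * k ^ (2 * d))"
      using long_chain_of_separated[OF q1 k1 fin cd' lt inj E] unfolding w_def by blast
    have W2: "W\<^sup>2 = 16 ^ J * w\<^sup>2" 
    proof -
      have "(4 ^ J)\<^sup>2 = (16::nat) ^ J" by (simp add: power2_eq_square flip: power_mult_distrib)
      then show ?thesis by (simp add: W_def power_mult_distrib)
    qed
    have "W\<^sup>2 \<le> (k * n)\<^sup>2" using Wk by (rule power_mono) simp
    moreover have "k\<^sup>2 = 2 ^ (2 * s)" unfolding k_def by (simp add: mult.commute flip: power_mult)
    ultimately have W2n: "W\<^sup>2 \<le> 2 ^ (2 * s) * n\<^sup>2" by (simp add: power_mult_distrib)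
    have dk: "d \<le> 2 ^ s" using ds by (simp add: k_def)
    have T1: "2 ^ (v + 2) * (d * q * k * (2 * 12 ^ J * w\<^sup>2)) \<le> n\<^sup>2"
    proof -
      have "2 ^ h * (12::nat) ^ J = 2 ^ h * (12 ^ 3) ^ h" by (simp only: J_def power_mult)
      also have "\<dots> = (2 * 12 ^ 3) ^ h" by (rule power_mult_distrib[symmetric])
      also have "\<dots> \<le> (16 ^ 3) ^ h" by (intro power_mono) auto
      also have "\<dots> = 16 ^ J" by (simp only: J_def power_mult)
      finally have hJ: "2 ^ h * 12 ^ J \<le> (16::nat) ^ J" .
      have "2 ^ h * (d * q * k * (2 * 12 ^ J * w\<^sup>2)) = d * q * k * 2 * (2 ^ h * 12 ^ J * w\<^sup>2)" by simp
      also have "\<dots> \<le> d * q * k * 2 * (16 ^ J * w\<^sup>2)" using hJ by (intro mult_left_mono mult_right_mono) auto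
      also have "\<dots> = d * q * k * 2 * W\<^sup>2" by (simp add: W2)
      also have "\<dots> \<le> 2 ^ s * q * k * 2 * (2 ^ (2 * s) * n\<^sup>2)" using dk W2n by (intro mult_mono) auto
      also have "\<dots> = 2 ^ (6 + 7 * s + v) * n\<^sup>2"
      proof -
        have "(2::nat) ^ (6 + 7 * s + v) = 2 ^ s * 2 ^ (5 + 3 * s + v) * 2 ^ s * 2 ^ 1 * 2 ^ (2 * s)"
          unfolding power_add[symmetric] by (rule arg_cong[of _ _ "power 2"]) simp
        then show ?thesis by (simp add: q_def k_def)
      qed
      finally have le: "2 ^ h * (d * q * k * (2 * 12 ^ J * w\<^sup>2)) \<le> 2 ^ (6 + 7 * s + v) * n\<^sup>2" .
      have "2 ^ (6 + 7 * s + v) * (2 ^ (v + 2) * (d * q * k * (2 * 12 ^ J * w\<^sup>2))) \<le> 2 ^ (6 + 7 * s + v) * n\<^sup>2"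
      proof -
        have "2 ^ h = 2 ^ (6 + 7 * s + v) * (2::nat) ^ (v + 2)"
          unfolding power_add[symmetric] by (rule arg_cong[of _ _ "power 2"]) (simp add: h_def)
        with le show ?thesis by (simp only: mult.assoc)
      qed
      then show ?thesis by (rule mult_left_le_imp_le) simp
    qed
    have T2: "2 ^ (v + 2) * (16 ^ J * (6 * d * q * k ^ (2 * d))) \<le> n\<^sup>2"
    proof -
      have "q * (16 ^ J * (6 * d * q * k ^ (2 * d))) = 6 * d * W\<^sup>2"
        unfolding W2 w_def by (simp add: power2_eq_square mult_2 power_add)
      also have "\<dots> \<le> 8 * 2 ^ s * (2 ^ (2 * s) * n\<^sup>2)" using dk W2n by (intro mult_mono) auto
      also have "\<dots> = 2 ^ (3 + 3 * s) * n\<^sup>2"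
      proof -
        have "(2::nat) ^ (3 + 3 * s) = 2 ^ 3 * 2 ^ s * 2 ^ (2 * s)"
          unfolding power_add[symmetric] by (rule arg_cong[of _ _ "power 2"]) simp
        then show ?thesis by simp
      qed
      finally have le: "q * (16 ^ J * (6 * d * q * k ^ (2 * d))) \<le> 2 ^ (3 + 3 * s) * n\<^sup>2" .
      have "q = 2 ^ (3 + 3 * s) * 2 ^ (v + 2)"
        unfolding q_def power_add[symmetric] by (rule arg_cong[of _ _ "power 2"]) simp
      then have "2 ^ (3 + 3 * s) * (2 ^ (v + 2) * z) \<le> y" if "q * z \<le> y" for y z
        using that by (simp only: mult.assoc)
      from this[OF le]
      have "2 ^ (3 + 3 * s) * (2 ^ (v + 2) * (16 ^ J * (6 * d * q * k ^ (2 * d)))) \<le> 2 ^ (3 + 3 * s) * n\<^sup>2" .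
      then show ?thesis by (rule mult_left_le_imp_le) simp
    qed
    have "4 * n\<^sup>2 \<le> 2 ^ (v + 2) * card E" using dense by simp
    also have "\<dots> \<le> 2 ^ (v + 2) * (2 ^ d * q * w * (16 ^ J * card F) + d * q * k * (2 * 12 ^ J * w\<^sup>2)
      + 16 ^ J * (6 * d * q * k ^ (2 * d)))" by (intro mult_left_mono F(3)) simp
    also have "\<dots> \<le> 2 ^ (v + 2) * (2 ^ d * q * w * (16 ^ J * card F)) + n\<^sup>2 + n\<^sup>2"
      unfolding distrib_left by (intro add_mono T1 T2 order_refl)
    finally have "2 * n\<^sup>2 \<le> 2 ^ (v + 2) * (2 ^ d * q * w * (16 ^ J * card F))" by simp
    also have "\<dots> = 2 ^ (v + 2) * 2 ^ d * q * 4 ^ J * card F * W"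
    proof -
      have "(16::nat) ^ J = 4 ^ J * 4 ^ J" by (simp flip: power_mult_distrib)
      then show ?thesis by (simp add: W_def)
    qed
    also have "\<dots> \<le> 2 ^ (v + 2) * 2 ^ s * q * 4 ^ J * card F * (k * n)"
      using ds(1) Wk by (intro mult_mono power_increasing order_refl) auto
    finally have "n * (2 * n) \<le> n * (2 * (2 ^ (v + 1) * 2 ^ s * q * 4 ^ J * k * card F))"
      by (simp add: power2_eq_square mult_ac)
    then have "n \<le> 2 ^ (v + 1) * 2 ^ s * q * 4 ^ J * k * card F" using n(1) by (simp add: mult_ac)
    also have "2 ^ (v + 1) * 2 ^ s * q * 4 ^ J * k = 2 ^ ((v + 1) + s + (5 + 3 * s + v) + 6 * h + s)"
      by (simp only: four q_def k_def power_add[symmetric])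
    also have "(v + 1) + s + (5 + 3 * s + v) + 6 * h + s = 54 + 47 * s + 14 * v" by (simp add: h_def)
    finally show ?thesis using F by blast
  qed
qed

section \<open>A vertical line crossed by many edges\<close>

text \<open>
  An edge crosses as many of the cuts just after a point of \<open>V\<close> as the ranks of its endpoints
  differ. At most \<open>card V * L\<close> edges join points whose ranks differ by less than
  \<open>L\<close>; every other one crosses at least \<open>L\<close> of the \<open>card V\<close> cuts. The
  conclusion is the resulting average, with the subtracted term moved to the right.
\<close>
lemma cut_crossed_by_many_edges:
  fixes f :: "'p \<Rightarrow> real"
  assumes "finite V" "V \<noteq> {}" "inj_on f V" and E: "E \<subseteq> {(p, q). p \<in> V \<and> q \<in> V \<and> f p < f q}"
  shows "\<exists>v\<in>V. L * card E \<le> card V * (card {(p, q) \<in> E. f p \<le> f v \<and> f v < f q} + L\<^sup>2)"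
proof -
  define \<rho> where "\<rho> a = card {x \<in> V. f x < f a}" for a
  have rho_strict: "\<rho> a < \<rho> b" if "f a < f b" "a \<in> V" for a b
    unfolding \<rho>_def using that assms(1) by (intro psubset_card_mono) auto
  have rho_inj: "inj_on \<rho> V"
    using rho_strict assms(3) by (metis inj_onD inj_onI linorder_neqE nat_neq_iff)
  define span where "span e = card {v \<in> V. f (fst e) \<le> f v \<and> f v < f (snd e)}" for e
  have span: "\<rho> (snd e) = \<rho> (fst e) + span e" if "e \<in> E" for e
  proof -
    have "f (fst e) < f (snd e)" using that E by auto
    then have "{x \<in> V. f x < f (snd e)} = {x \<in> V. f x < f (fst e)} \<union> {v \<in> V. f (fst e) \<le> f v \<and> f v < f (snd e)}"
      by auto
    then show ?thesis unfolding \<rho>_def span_def using assms(1) by (simp add: card_Un_disjoint disjoint_iff)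
  qed
  have finE: "finite E" by (rule finite_subset[of _ "V \<times> V"]) (use assms(1) E in auto)
  define S where "S = {e \<in> E. span e < L}"
  have "S \<subseteq> (SIGMA p:V. {q \<in> V. \<rho> p \<le> \<rho> q \<and> \<rho> q < \<rho> p + L})"
    using span E by (fastforce simp: S_def)
  then have "card S \<le> card (SIGMA p:V. {q \<in> V. \<rho> p \<le> \<rho> q \<and> \<rho> q < \<rho> p + L})"
    using assms(1) by (intro card_mono) auto
  also have "\<dots> = (\<Sum>p\<in>V. card {q \<in> V. \<rho> p \<le> \<rho> q \<and> \<rho> q < \<rho> p + L})" using assms(1) by simp
  also have "\<dots> \<le> (\<Sum>p\<in>V. L)"
  proof (intro sum_mono)
    fix p
    have "card {q \<in> V. \<rho> p \<le> \<rho> q \<and> \<rho> q < \<rho> p + L} \<le> card {\<rho> p..<\<rho> p + L}"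
      by (rule card_inj_on_le[of \<rho>]) (use inj_on_subset[OF rho_inj] in auto)
    then show "card {q \<in> V. \<rho> p \<le> \<rho> q \<and> \<rho> q < \<rho> p + L} \<le> L" by simp
  qed
  finally have S: "card S \<le> card V * L" by simp
  have "L * card (E - S) = (\<Sum>e\<in>E - S. L)" by simp
  also have "\<dots> \<le> (\<Sum>e\<in>E - S. span e)" by (intro sum_mono) (auto simp: S_def)
  also have "\<dots> \<le> (\<Sum>e\<in>E. span e)" using finE by (intro sum_mono2) auto
  also have "\<dots> = (\<Sum>e\<in>E. \<Sum>v\<in>V. if f (fst e) \<le> f v \<and> f v < f (snd e) then 1 else 0)"
    unfolding span_def using assms(1) by (intro sum.cong refl sum_indicator_eq_card[symmetric])
  also have "\<dots> = (\<Sum>v\<in>V. \<Sum>e\<in>E. if f (fst e) \<le> f v \<and> f v < f (snd e) then 1 else 0)" by (rule sum.swap)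
  also have "\<dots> = (\<Sum>v\<in>V. card {e \<in> E. f (fst e) \<le> f v \<and> f v < f (snd e)})"
    using finE by (intro sum.cong refl sum_indicator_eq_card)
  finally have 1: "L * card (E - S) \<le> (\<Sum>v\<in>V. card {e \<in> E. f (fst e) \<le> f v \<and> f v < f (snd e)})" .
  obtain v where v: "v \<in> V" "(\<Sum>v\<in>V. card {e \<in> E. f (fst e) \<le> f v \<and> f v < f (snd e)})
      \<le> card V * card {e \<in> E. f (fst e) \<le> f v \<and> f v < f (snd e)}"
    using nat_sum_le_card_times_some[OF assms(1,2)] by blast
  have "card E = card (E - S) + card S"
    using finE by (metis (no_types, lifting) S_def card_Diff_subset card_mono finite_Collect_conjI le_add_diff_inverse2 mem_Collect_eq rev_finite_subset subsetI)
  then have "L * card E = L * card (E - S) + L * card S" by (simp add: distrib_left)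
  also have "\<dots> \<le> card V * card {e \<in> E. f (fst e) \<le> f v \<and> f v < f (snd e)} + L * (card V * L)"
    using 1 v(2) S by (intro add_mono mult_left_mono) auto
  also have "\<dots> = card V * (card {(p, q) \<in> E. f p \<le> f v \<and> f v < f q} + L\<^sup>2)"
  proof -
    have "{(p, q) \<in> E. f p \<le> f v \<and> f v < f q} = {e \<in> E. f (fst e) \<le> f v \<and> f v < f (snd e)}" by auto
    then show ?thesis by (simp add: power2_eq_square algebra_simps)
  qed
  finally show ?thesis using v(1) by blast
qed

text \<open>
  Take \<open>L\<close> about a quarter of the average degree, so that at most half of the edges are short.
  The density gets squared up to a constant factor. Excluding small \<open>V\<close> keeps the rounding of
  \<open>L\<close> harmless.
\<close>
lemma dense_cut:
  fixes f :: "'p \<Rightarrow> real"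
  assumes "finite V" "V \<noteq> {}" "inj_on f V" and E: "E \<subseteq> {(p, q). p \<in> V \<and> q \<in> V \<and> f p < f q}"
    and large: "card V > 2 ^ (v + 2)" and dense: "(card V)\<^sup>2 \<le> 2 ^ v * card E"
  shows "\<exists>x\<in>V. (card V)\<^sup>2 \<le> 2 ^ (2 * v + 3) * card {(p, q) \<in> E. f p \<le> f x \<and> f x < f q}"
proof -
  define n where "n = card V"
  have n: "n > 0" using assms(1,2) by (simp add: n_def card_gt_0_iff)
  define L where "L = card E div (2 * n)"
  obtain x where x: "x \<in> V" and c: "L * card E \<le> n * (card {(p, q) \<in> E. f p \<le> f x \<and> f x < f q} + L\<^sup>2)"
    using cut_crossed_by_many_edges[OF assms(1-4), of L] unfolding n_def by blast
  define m where "m = card {(p, q) \<in> E. f p \<le> f x \<and> f x < f q}"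
  have "2 ^ (v + 2) * n < n * n" using large n by (simp add: n_def)
  also have "n * n \<le> 2 ^ v * card E" using dense by (simp add: n_def power2_eq_square)
  finally have "4 * n < card E" by simp
  moreover have "card E < 2 * n * (L + 1)"
    unfolding L_def using n by (metis Suc_eq_plus1 dividend_less_times_div mult_Suc_right add.commute nat_0_less_mult_iff pos2 mult.commute)
  ultimately have L4: "card E \<le> 4 * n * L" by (cases L) (auto simp: algebra_simps)
  have L2: "2 * (n * L) \<le> card E" unfolding L_def by (metis mult.assoc mult.commute times_div_less_eq_dividend)
  have "2 * (L * card E) \<le> 2 * (n * m) + 2 * (n * L) * L"
    using c by (simp add: m_def algebra_simps power2_eq_square)
  also have "2 * (n * L) * L \<le> card E * L" by (intro mult_right_mono L2) simp
  finally have "L * card E \<le> 2 * (n * m)" by simp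
  then have "4 * n * L * card E \<le> 8 * n\<^sup>2 * m" by (simp add: power2_eq_square mult_ac)
  moreover have "card E * card E \<le> 4 * n * L * card E" by (intro mult_right_mono L4) simp
  ultimately have EE: "card E * card E \<le> 8 * n\<^sup>2 * m" by linarith
  have "n\<^sup>2 * n\<^sup>2 \<le> (2 ^ v * card E) * (2 ^ v * card E)"
    using dense by (intro mult_mono) (auto simp: n_def)
  also have "\<dots> = 2 ^ (2 * v) * (card E * card E)" by (simp add: mult_2 power_add)
  also have "\<dots> \<le> 2 ^ (2 * v) * (8 * n\<^sup>2 * m)" by (intro mult_left_mono EE) simp
  also have "\<dots> = n\<^sup>2 * (2 ^ (2 * v + 3) * m)" by (simp add: power_add)
  finally have "n\<^sup>2 * n\<^sup>2 \<le> n\<^sup>2 * (2 ^ (2 * v + 3) * m)" .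
  then have "n\<^sup>2 \<le> 2 ^ (2 * v + 3) * m" by (rule mult_left_le_imp_le) (use n in simp)
  then show ?thesis using x unfolding m_def n_def by blast
qed

section \<open>Evading segments in the plane\<close>

lemma affine_hull_segment_disjoint:
  fixes a b c d :: "real ^ 2"
  assumes "\<alpha> + \<beta> * a$1 + \<gamma> * a$2 = 0" "\<alpha> + \<beta> * b$1 + \<gamma> * b$2 = 0"
    and "\<alpha> + \<beta> * c$1 + \<gamma> * c$2 > 0" "\<alpha> + \<beta> * d$1 + \<gamma> * d$2 > 0"
  shows "affine hull (closed_segment a b) \<inter> closure (closed_segment c d) = {}"
proof -
  define h where "h p = \<alpha> + \<beta> * p$1 + \<gamma> * p$2" for p :: "real ^ 2"
  have h: "h (u *\<^sub>R x + v *\<^sub>R y) = u * h x + v * h y" if "u + v = 1" for u v x y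
  proof -
    have u: "u = 1 - v" using that by simp
    show ?thesis unfolding h_def u by (simp add: algebra_simps)
  qed
  have "h p = 0" if "p \<in> affine hull (closed_segment a b)" for p
  proof -
    have "p \<in> affine hull {a, b}" using that by (simp add: segment_convex_hull affine_hull_convex_hull)
    then show ?thesis using h assms(1,2) by (auto simp: affine_hull_2 h_def[symmetric])
  qed
  moreover have "h p > 0" if p: "p \<in> closed_segment c d" for p
  proof -
    obtain u where u: "0 \<le> u" "u \<le> 1" "p = (1 - u) *\<^sub>R c + u *\<^sub>R d"
      using p unfolding closed_segment_def by blast
    then have "h p = (1 - u) * h c + u * h d" using h[of "1 - u" u] by simp
    moreover have "\<dots> > 0" using u(1,2) assms(3,4) unfolding h_def[symmetric]
      by (cases "u = 0") (auto intro: add_nonneg_pos)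
    ultimately show ?thesis by simp
  qed
  ultimately show ?thesis by (force simp: closed_segment)
qed

lemma slope_less_iff:
  assumes "X a < X b" "X c < X d"
  shows "slope X Y a b < slope X Y c d \<longleftrightarrow> (Y b - Y a) * (X d - X c) < (Y d - Y c) * (X b - X a)"
proof -
  have "X b - X a > 0" "X d - X c > 0" using assms by simp_all
  then show ?thesis unfolding slope_def by (simp add: pos_divide_less_eq pos_less_divide_eq)
qed

text \<open>
  The orientation determinant \<open>h a b\<close> vanishes on the line \<open>ab\<close>, and two of the
  four inequalities between slopes say that it is positive at \<open>a'\<close> and \<open>b'\<close>; the
  other two say that \<open>a\<close> and \<open>b\<close> lie below the line \<open>a'b'\<close>. The shear
  does not change the lines, so it affects only the coefficients of \<open>h\<close>.
\<close>
lemma evading_if_prec: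
  fixes t :: real and X Y :: "real ^ 2 \<Rightarrow> real"
  defines "X \<equiv> \<lambda>p. p$1 + t * p$2" and "Y \<equiv> \<lambda>p. p$2"
  assumes lt: "X a < X b" "X a < X b'" "X a' < X b" "X a' < X b'"
    and pr: "prec (slope X Y) (a, b) (a', b')"
  shows "evading (convex hull {a, b}) (convex hull {a', b'})"
proof -
  define h where "h a b p = (X a * Y b - Y a * X b) + (Y a - Y b) * X p + (X b - X a) * Y p" for a b p
  have h: "h a b p = (X a * Y b - Y a * X b) + (Y a - Y b) * p$1 + ((Y a - Y b) * t + (X b - X a)) * p$2" for a b p
    by (simp add: h_def X_def Y_def algebra_simps)
  have *: "slope X Y a' b < slope X Y a b" "slope X Y a' b' < slope X Y a b'"
    "slope X Y a b < slope X Y a b'" "slope X Y a' b < slope X Y a' b'"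
    using pr by (auto simp: prec_def)
  have pos: "h a b a' > 0" "h a b b' > 0" "h b' a' a > 0" "h b' a' b > 0"
    using *(1)[unfolded slope_less_iff[of X, OF lt(3,1)]] *(3)[unfolded slope_less_iff[of X, OF lt(1,2)]]
      *(2)[unfolded slope_less_iff[of X, OF lt(4,2)]] *(4)[unfolded slope_less_iff[of X, OF lt(3,4)]]
    by (simp_all add: h_def algebra_simps)
  have zero: "h a b a = 0" "h a b b = 0" "h b' a' a' = 0" "h b' a' b' = 0"
    by (simp_all add: h_def algebra_simps)
  have "affine hull (closed_segment a b) \<inter> closure (closed_segment a' b') = {}"
    using zero(1,2) pos(1,2) unfolding h by (rule affine_hull_segment_disjoint)
  moreover have "affine hull (closed_segment a' b') \<inter> closure (closed_segment a b) = {}"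
    using zero(3,4) pos(3,4) unfolding h by (rule affine_hull_segment_disjoint)
  ultimately show ?thesis by (simp add: evading_def segment_convex_hull)
qed

lemma collinear_if_slope_eq:
  fixes t :: real and X Y :: "real ^ 2 \<Rightarrow> real"
  defines "X \<equiv> \<lambda>p. p$1 + t * p$2" and "Y \<equiv> \<lambda>p. p$2"
  assumes ne: "X a \<noteq> X b" "X a' \<noteq> X b" and eq: "slope X Y a b = slope X Y a' b"
  shows "collinear {a, a', b}"
proof -
  define c where "c = (X b - X a') / (X b - X a)"
  have x: "X b - X a' = c * (X b - X a)" using ne by (simp add: c_def)
  have y: "Y b - Y a' = c * (Y b - Y a)"
    using ne eq by (simp add: c_def slope_def field_simps)
  have "a' = c *\<^sub>R a + (1 - c) *\<^sub>R b"
  proof -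
    have "a' $ 2 = c * a $ 2 + (1 - c) * b $ 2" using y by (simp add: Y_def algebra_simps)
    moreover have "a' $ 1 = c * a $ 1 + (1 - c) * b $ 1"
      using x arg_cong[OF y, of "\<lambda>z. t * z"] by (simp add: X_def Y_def algebra_simps)
    ultimately show ?thesis by (simp add: vec_eq_iff forall_2)
  qed
  then show ?thesis unfolding collinear_3_expand by blast
qed

lemma slope_inj_if_general_position:
  fixes t :: real and X Y :: "real ^ 2 \<Rightarrow> real"
  defines "X \<equiv> \<lambda>p. p$1 + t * p$2" and "Y \<equiv> \<lambda>p. p$2"
  assumes gp: "general_position V" and inj: "inj_on X V" and sub: "b \<in> V" "A \<subseteq> V - {b}"
  shows "inj_on (\<lambda>a. slope X Y a b) A"
proof (rule inj_onI, rule ccontr)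
  fix a a' assume *: "a \<in> A" "a' \<in> A" "slope X Y a b = slope X Y a' b" "a \<noteq> a'"
  then have "collinear {a, a', b}"
    using * inj sub unfolding X_def Y_def by (intro collinear_if_slope_eq) (auto dest: inj_onD)
  moreover have "a \<noteq> b" "a' \<noteq> b" using * sub by blast+
  then have "card {a, a', b} = 3" "{a, a', b} \<subseteq> V" using * sub by auto
  ultimately show False using gp unfolding general_position_def by blast
qed

text \<open>
  Two distinct points get the same sheared abscissa for at most one value of \<open>t\<close>.
\<close>
lemma generic_direction:
  fixes V :: "(real ^ 2) set"
  assumes "finite V"
  obtains t where "inj_on (\<lambda>p. p$1 + t * p$2) V"
proof -
  have "finite ((\<lambda>(p, q). (q$1 - p$1) / (p$2 - q$2)) ` (V \<times> V))" using assms by simp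
  then obtain t where t: "t \<notin> (\<lambda>(p, q). (q$1 - p$1) / (p$2 - q$2)) ` (V \<times> V)"
    using ex_new_if_finite[OF infinite_UNIV_char_0] by blast
  have "inj_on (\<lambda>p. p$1 + t * p$2) V"
  proof (rule inj_onI, rule ccontr)
    fix p q assume *: "p \<in> V" "q \<in> V" "p$1 + t * p$2 = q$1 + t * q$2" "p \<noteq> q"
    have "p$2 \<noteq> q$2"
    proof
      assume "p$2 = q$2"
      then show False using * by (simp add: vec_eq_iff forall_2)
    qed
    then have "t = (q$1 - p$1) / (p$2 - q$2)" using *(3) by (simp add: field_simps)
    then show False using t * by force
  qed
  then show ?thesis using that by blast
qed

text \<open>
  Both claims of the theorem in one estimate, for a graph of density at least \<open>2 ^ - v\<close> and
  with \<open>s\<^sup>2\<close> an upper bound for the binary logarithm of \<open>card V\<close>. Passing to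
  the edges across one vertical line changes \<open>v\<close> into \<open>2 * v + 3\<close>.
\<close>
theorem many_evading_edges:
  fixes V :: "(real ^ 2) set" and s v :: nat
  assumes G: "geometric_graph V E" and s: "s \<ge> 1" and n: "card V \<ge> 1" "card V \<le> 2 ^ (s * s)"
    and dense: "(card V)\<^sup>2 \<le> 2 ^ v * card E"
  shows "\<exists>F\<subseteq>E. pairwise evading_edges F \<and> card V \<le> 2 ^ (143 * s + 28 * v) * card F"
proof (cases "card V \<le> 2 ^ (v + 2)")
  \<comment> \<open>One edge is enough.\<close>
  case True
  have "card E \<noteq> 0" using dense n(1) by (cases "card E = 0") auto
  then have "E \<noteq> {}" by auto
  then obtain e where "e \<in> E" by blast
  moreover have "card V \<le> 2 ^ (143 * s + 28 * v)"
    using True by (rule order_trans) (intro power_increasing, use s in auto)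
  ultimately show ?thesis by (intro exI[of _ "{e}"]) (auto simp: pairwise_def)
next
  case False
  have fin: "finite V" and gp: "general_position V" and E: "\<And>e. e \<in> E \<Longrightarrow> e \<subseteq> V \<and> card e = 2"
    using G by (auto simp: geometric_graph_def)
  obtain t where t: "inj_on (\<lambda>p. p$1 + t * p$2) V" using generic_direction[OF fin] .
  define X Y where "X = (\<lambda>p::real^2. p$1 + t * p$2)" and "Y = (\<lambda>p::real^2. p$2)"
  have inj: "inj_on X V" using t by (simp add: X_def)
  define D where "D = {(p, q). p \<in> V \<and> q \<in> V \<and> X p < X q \<and> {p, q} \<in> E}"
  have finD: "finite D" by (rule finite_subset[of _ "V \<times> V"]) (use fin in \<open>auto simp: D_def\<close>)
  have "E \<subseteq> (\<lambda>(p, q). {p, q}) ` D"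
  proof
    fix e assume e: "e \<in> E"
    then obtain p q where pq: "e = {p, q}" "p \<noteq> q" using E[OF e] by (meson card_2_iff)
    then have V: "p \<in> V" "q \<in> V" using E[OF e] by auto
    then have "X p \<noteq> X q" using inj pq(2) by (auto dest: inj_onD)
    then have "(p, q) \<in> D \<or> (q, p) \<in> D" using V e pq by (auto simp: D_def insert_commute)
    then show "e \<in> (\<lambda>(p, q). {p, q}) ` D" using pq(1) by force
  qed
  then have "card E \<le> card D" using finD by (rule surj_card_le[rotated])
  then have "(card V)\<^sup>2 \<le> 2 ^ v * card D" using dense by (meson le_trans mult_le_mono2)
  then obtain x where x: "x \<in> V" "(card V)\<^sup>2 \<le> 2 ^ (2 * v + 3) * card {(p, q) \<in> D. X p \<le> X x \<and> X x < X q}"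
    using dense_cut[OF fin _ inj, of D v] False n(1) by (force simp: D_def)
  define A B where "A = {p \<in> V. X p \<le> X x}" and "B = {q \<in> V. X x < X q}"
  define D' where "D' = {(p, q) \<in> D. X p \<le> X x \<and> X x < X q}"
  have sub: "A \<subseteq> V" "B \<subseteq> V" by (auto simp: A_def B_def)
  have lt: "X a < X b" if "a \<in> A" "b \<in> B" for a b using that by (auto simp: A_def B_def)
  have sl: "slope X Y a b = slope X Y b a" for a b
    unfolding slope_def by (metis minus_diff_eq minus_divide_divide)
  have injA: "inj_on (\<lambda>a. slope X Y a b) A" if "b \<in> B" for b
    unfolding X_def Y_def
    by (rule slope_inj_if_general_position[OF gp t]) (use that sub lt[of _ b] in auto)
  have injB: "inj_on (\<lambda>b. slope X Y a b) B" if "a \<in> A" for a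
    unfolding sl[of a] unfolding X_def Y_def
    by (rule slope_inj_if_general_position[OF gp t]) (use that sub lt[of a] in auto)
  have "\<exists>F\<subseteq>D'. chain (slope X Y) F \<and> card V \<le> 2 ^ (54 + 47 * s + 14 * (2 * v + 3)) * card F"
  proof (rule long_chain_length[OF s n])
    show "finite A" "finite B" "card A \<le> card V" "card B \<le> card V"
      using sub fin by (auto intro: finite_subset card_mono)
    show "inj_on X A" "inj_on X B" using inj sub by (auto intro: inj_on_subset)
    show "D' \<subseteq> A \<times> B" by (auto simp: D'_def D_def A_def B_def)
  qed (use lt injA injB x(2) in \<open>auto simp: D'_def\<close>)
  then obtain F where F: "F \<subseteq> D'" "chain (slope X Y) F" "card V \<le> 2 ^ (54 + 47 * s + 14 * (2 * v + 3)) * card F"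
    by blast
  have ev: "evading (convex hull {p, q}) (convex hull {p', q'})"
    if "(p, q) \<in> F" "(p', q') \<in> F" "prec (slope X Y) (p, q) (p', q')" for p q p' q'
  proof -
    have "p \<in> A" "p' \<in> A" "q \<in> B" "q' \<in> B" using that F(1) by (auto simp: D'_def D_def A_def B_def)
    then show ?thesis
      using evading_if_prec[of p t q q' p'] lt that(3) unfolding X_def Y_def by blast
  qed
  let ?e = "\<lambda>(p, q). {p, q} :: (real ^ 2) set"
  have "inj_on ?e F"
  proof (rule inj_onI, clarify)
    fix p q p' q' assume *: "(p, q) \<in> F" "(p', q') \<in> F" "{p, q} = {p', q'}"
    then have "X p < X q" "X p' < X q'" using F(1) by (auto simp: D'_def D_def)
    then show "p = p' \<and> q = q'" using *(3) by (auto simp: doubleton_eq_iff)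
  qed
  then have "card (?e ` F) = card F" by (rule card_image)
  moreover have "?e ` F \<subseteq> E" using F(1) by (auto simp: D'_def D_def)
  moreover have "pairwise evading_edges (?e ` F)"
  proof (rule pairwiseI)
    fix e e' assume "e \<in> ?e ` F" "e' \<in> ?e ` F" "e \<noteq> e'"
    then obtain p q p' q' where *: "(p, q) \<in> F" "(p', q') \<in> F" "e = {p, q}" "e' = {p', q'}" "(p, q) \<noteq> (p', q')" by auto
    then have "prec (slope X Y) (p, q) (p', q') \<or> prec (slope X Y) (p', q') (p, q)"
      using F(2) unfolding chain_def pairwise_def by blast
    then show "evading_edges e e'" using ev[OF *(1,2)] ev[OF *(2,1)] *(3,4)
      unfolding evading_edges_def evading_def by blast
  qed
  moreover have "card V \<le> 2 ^ (143 * s + 28 * v) * card F"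
    using F(3) by (rule order_trans) (intro mult_right_mono power_increasing, use s in auto)
  ultimately show ?thesis by (intro exI[of _ "?e ` F"]) simp
qed

lemma sqrt_log_scale:
  fixes n :: nat
  assumes "n \<ge> 2"
  obtains s :: nat where "s \<ge> 1" "n \<le> 2 ^ (s * s)" "real s \<le> 2 * sqrt (log 2 n)"
proof -
  define l where "l = log 2 (real n)"
  have l: "l \<ge> 1" using assms by (simp add: l_def le_log_iff)
  then have sq: "sqrt l \<ge> 1" by simp
  \<comment> \<open>Rounding up costs at most 1, and this is at most \<open>sqrt (log 2 n)\<close> because \<open>n \<ge> 2\<close>.\<close>
  define s where "s = nat \<lceil>sqrt l\<rceil>"
  have s: "sqrt l \<le> real s" "real s \<le> sqrt l + 1" using sq unfolding s_def by linarith+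
  have "l = sqrt l * sqrt l" using l by simp
  also have "\<dots> \<le> real s * real s" using s(1) sq by (intro mult_mono) auto
  finally have "l \<le> real (s * s)" by simp
  then have "2 powr l \<le> 2 powr real (s * s)" by (rule powr_mono) simp
  also have "2 powr l = real n" using assms by (simp add: l_def)
  also have "2 powr real (s * s) = real (2 ^ (s * s))" by (simp add: powr_realpow del: of_nat_mult)
  finally have "real n \<le> real (2 ^ (s * s))" .
  then have "n \<le> 2 ^ (s * s)" by (metis of_nat_le_iff)
  moreover have "s \<ge> 1" "real s \<le> 2 * sqrt l" using s sq by linarith+
  ultimately show ?thesis using that unfolding l_def by blast
qed

theorem theorem4p1:
  shows "(\<exists>C::real. C > 0 \<and>
           (\<forall>n::nat. n \<ge> 2 \<longrightarrow>
             (\<forall>V :: (real ^ 2) set. finite V \<and> card V = n \<and> general_position V \<longrightarrow>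
               (\<exists>F \<subseteq> determined_segments V. pairwise evading F \<and>
                  real (card F) \<ge> real n / 2 powr (C * sqrt (log 2 (real n)))))))
       \<and> (\<exists>c::real.
           (\<forall>n::nat. n \<ge> 2 \<longrightarrow>
             (\<forall>\<epsilon>::real. \<epsilon> > log 2 (real n) powr (- 2 / 3) \<longrightarrow>
               (\<forall>(V :: (real ^ 2) set) E. geometric_graph V E \<and> card V = n \<and>
                    real (card E) \<ge> real n powr (2 - \<epsilon>) \<longrightarrow>
                 (\<exists>F \<subseteq> E. pairwise evading_edges F \<and>
                    real (card F) \<ge> real n powr (1 - c * sqrt \<epsilon>))))))"
  \<comment> \<open>One constant serves both claims. In the exponent \<open>143 * s + 28 * v\<close> of \<open>many_evading_edges\<close>, the complete graph
    has \<open>v = 2\<close>, and \<open>143 * s + 56 \<le> 199 * s \<le> 398 * sqrt (log 2 n)\<close>. For the second claim \<open>v \<le> \<epsilon> * log 2 n + 1\<close>, and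
    each of \<open>\<epsilon> * log 2 n\<close>, \<open>1\<close> and \<open>sqrt (log 2 n)\<close> is at most \<open>sqrt \<epsilon> * log 2 n\<close>, where \<open>28 + 28 + 286 \<le> 398\<close>.\<close>
proof (intro conjI exI[of _ "398::real"] allI impI)
  show "(398::real) > 0" by simp
next
  fix n :: nat and V :: "(real ^ 2) set"
  assume n: "n \<ge> 2" and V: "finite V \<and> card V = n \<and> general_position V"
  define E where "E = {e. e \<subseteq> V \<and> card e = 2}"
  have G: "geometric_graph V E" using V by (auto simp: geometric_graph_def E_def)
  have cE: "card E = n choose 2" using V by (simp add: E_def n_subsets)
  have "n\<^sup>2 \<le> 2 ^ 2 * card E"
  proof -
    have "n\<^sup>2 \<le> 2 * (n * (n - 1))" using n by (cases n) (auto simp: power2_eq_square)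
    moreover have "even (n * (n - 1))" by (cases "even n") auto
    then have "n * (n - 1) = 2 * card E" unfolding cE choose_two by simp
    ultimately show ?thesis by simp
  qed
  moreover obtain s :: nat where s: "s \<ge> 1" "n \<le> 2 ^ (s * s)" "real s \<le> 2 * sqrt (log 2 n)"
    using sqrt_log_scale[OF n] .
  ultimately obtain F where F: "F \<subseteq> E" "pairwise evading_edges F" "n \<le> 2 ^ (143 * s + 28 * 2) * card F"
    using many_evading_edges[OF G s(1), of 2] V n by auto
  have ne: "e \<noteq> {}" if "e \<in> F" for e using F(1) that by (auto simp: E_def)
  have "inj_on ((hull) convex) F"
  proof (rule inj_onI, rule ccontr)
    fix e f assume *: "e \<in> F" "f \<in> F" "convex hull e = convex hull f" "e \<noteq> f"
    then have "evading (convex hull e) (convex hull e)"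
      using F(2) by (force simp: pairwise_def evading_edges_def)
    then have disj: "affine hull (convex hull e) \<inter> closure (convex hull e) = {}"
      by (simp add: evading_def)
    obtain x where "x \<in> e" using ne[OF *(1)] by blast
    then have x: "x \<in> convex hull e" by (rule hull_inc)
    have "x \<in> affine hull (convex hull e)" using x by (rule hull_inc)
    moreover have "x \<in> closure (convex hull e)" using x closure_subset by (rule rev_subsetD)
    ultimately show False using disj by blast
  qed
  then have card: "card ((hull) convex ` F) = card F" by (rule card_image)
  have "real n \<le> real (2 ^ (143 * s + 28 * 2) * card F)" using F(3) by (rule of_nat_mono)
  also have "\<dots> = 2 powr real (143 * s + 28 * 2) * card F" by (subst powr_realpow) simp_all
  also have "\<dots> \<le> 2 powr (398 * sqrt (log 2 n)) * card F"
  proof (intro mult_right_mono powr_mono)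
    have "real (143 * s + 28 * 2) \<le> 199 * real s" using s(1) by simp
    then show "real (143 * s + 28 * 2) \<le> 398 * sqrt (log 2 n)" using s(3) by linarith
  qed auto
  finally have "real (card F) \<ge> real n / 2 powr (398 * sqrt (log 2 n))"
    by (simp add: divide_le_eq mult.commute)
  moreover have "(hull) convex ` F \<subseteq> determined_segments V"
  proof clarify
    fix e assume "e \<in> F"
    then have "e \<subseteq> V" "card e = 2" using F(1) by (auto simp: E_def)
    then obtain a b where "e = {a, b}" "a \<noteq> b" "a \<in> V" "b \<in> V" by (auto simp: card_2_iff)
    then show "convex hull e \<in> determined_segments V"
      unfolding determined_segments_def segment_convex_hull by blast
  qed
  moreover have "pairwise evading ((hull) convex ` F)"
    using F(2) unfolding pairwise_image by (simp add: pairwise_def evading_edges_def)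
  ultimately show "\<exists>F\<subseteq>determined_segments V. pairwise evading F \<and> real (card F) \<ge> real n / 2 powr (398 * sqrt (log 2 n))"
    unfolding card[symmetric] by (intro exI[of _ "(hull) convex ` F"] conjI)
next
  fix n :: nat and \<epsilon> :: real and V E
  assume n: "n \<ge> 2" and eps: "\<epsilon> > log 2 n powr (- 2 / 3)"
    and G: "geometric_graph V E \<and> card V = n \<and> real (card E) \<ge> real n powr (2 - \<epsilon>)"
  define l where "l = log 2 n"
  have l: "l \<ge> 1" using n by (simp add: l_def le_log_iff)
  have n_l: "real n = 2 powr l" using n by (simp add: l_def)
  have e0: "\<epsilon> > 0" using eps by (meson le_less_trans powr_ge_zero)
  show "\<exists>F\<subseteq>E. pairwise evading_edges F \<and> real (card F) \<ge> real n powr (1 - 398 * sqrt \<epsilon>)"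
  proof (cases "\<epsilon> \<le> 1")
    case False
    have "real n powr (2 - \<epsilon>) > 0" using n by simp
    then have "E \<noteq> {}" using G by auto
    then obtain e where "e \<in> E" by blast
    moreover have "sqrt \<epsilon> \<ge> 1" using False by simp
    then have "l * (1 - 398 * sqrt \<epsilon>) \<le> 0" using l by (intro mult_nonneg_nonpos) linarith+
    then have "real n powr (1 - 398 * sqrt \<epsilon>) \<le> 2 powr 0"
      unfolding n_l powr_powr by (rule powr_mono) simp
    ultimately show ?thesis by (intro exI[of _ "{e}"]) (auto simp: pairwise_def)
  next
    case True
    obtain s :: nat where s: "s \<ge> 1" "n \<le> 2 ^ (s * s)" "real s \<le> 2 * sqrt l"
      using sqrt_log_scale[OF n] unfolding l_def .
    define v where "v = nat \<lceil>\<epsilon> * l\<rceil>"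
    have v: "\<epsilon> * l \<le> real v" "real v \<le> \<epsilon> * l + 1" using e0 l unfolding v_def by simp_all
    have "real (n\<^sup>2) = 2 powr (\<epsilon> * l) * real n powr (2 - \<epsilon>)"
    proof -
      have "real (n\<^sup>2) = real n powr 2" using n by (simp add: powr_numeral)
      also have "\<dots> = 2 powr (\<epsilon> * l) * real n powr (2 - \<epsilon>)"
        unfolding n_l powr_powr powr_add[symmetric] by (simp add: algebra_simps)
      finally show ?thesis .
    qed
    also have "\<dots> \<le> 2 powr real v * real (card E)" using v(1) G by (intro mult_mono powr_mono) auto
    also have "\<dots> = real (2 ^ v * card E)" by (simp add: powr_realpow)
    finally have "n\<^sup>2 \<le> 2 ^ v * card E" by (simp only: of_nat_le_iff)
    then obtain F where F: "F \<subseteq> E" "pairwise evading_edges F" "n \<le> 2 ^ (143 * s + 28 * v) * card F"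
      using many_evading_edges[of V E s v] s G n by auto
    have "l powr (- 1) \<le> l powr (- 2 / 3)" using l by (intro powr_mono) auto
    then have "1 / l \<le> \<epsilon>" using eps l by (simp add: l_def powr_minus_divide)
    then have el: "1 \<le> \<epsilon> * l" using l by (simp add: divide_le_eq)
    have a1: "\<epsilon> * l \<le> sqrt \<epsilon> * l"
    proof -
      have "\<epsilon> = sqrt \<epsilon> * sqrt \<epsilon>" using e0 by simp
      also have "\<dots> \<le> sqrt \<epsilon> * 1" using True e0 by (intro mult_left_mono) auto
      finally show ?thesis using l by (intro mult_right_mono) auto
    qed
    have a2: "sqrt l \<le> sqrt \<epsilon> * l"
    proof -
      have "sqrt l * 1 \<le> sqrt l * sqrt (\<epsilon> * l)" using el l by (intro mult_left_mono) auto
      also have "\<dots> = sqrt \<epsilon> * (sqrt l * sqrt l)" by (simp add: real_sqrt_mult)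
      also have "\<dots> = sqrt \<epsilon> * l" using l by simp
      finally show ?thesis by simp
    qed
    have a3: "1 \<le> sqrt \<epsilon> * l" using a1 el by linarith
    have "real n \<le> real (2 ^ (143 * s + 28 * v) * card F)" using F(3) by (rule of_nat_mono)
    also have "\<dots> = 2 powr real (143 * s + 28 * v) * card F" by (subst powr_realpow) simp_all
    also have "\<dots> \<le> 2 powr (398 * (sqrt \<epsilon> * l)) * card F"
    proof (intro mult_right_mono powr_mono)
      have "real (143 * s + 28 * v) = 143 * real s + 28 * real v" by simp
      then show "real (143 * s + 28 * v) \<le> 398 * (sqrt \<epsilon> * l)" using s(3) v(2) a1 a2 a3 by linarith
    qed auto
    finally have "2 powr l / 2 powr (398 * (sqrt \<epsilon> * l)) \<le> real (card F)"
      by (simp add: n_l divide_le_eq mult.commute)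
    moreover have "real n powr (1 - 398 * sqrt \<epsilon>) = 2 powr l / 2 powr (398 * (sqrt \<epsilon> * l))"
      unfolding n_l powr_powr powr_diff[symmetric] by (simp add: algebra_simps)
    ultimately show ?thesis using F by auto
  qed
qed

end
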